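(* Let $\{\lambda_n\}_{n=1}^\infty$ be a bounded sequence of complex numbers with $\lambda_n\in\Pi(T_n)$ for each $n\in\mathbb{N}$. Suppose that $1\in\nabla_{\mathfrak b}(\{\lambda_nT_n\})$. Then the sequence $\{\boldsymbol{T}_{n|\lambda_n}\}_{n=1}^\infty$ of resolvent kernels is relatively compact in $C(\mathbb{R}^2,\mathbb{C})$, and hence each sequence of positive integers contains a subsequence $\{n_k\}_{k=1}^\infty$ along which $\boldsymbol{T}_{n_k|\lambda_{n_k}}$ converges in the norm of $C(\mathbb{R}^2,\mathbb{C})$.
   Context: $L^2=L^2(\mathbb{R})$ is the complex Hilbert space with inner product $\langle f,g\rangle=\int f(s)\overline{g(s)}\,ds$ (integrals without indicated domain are over $\mathbb{R}$, Lebesgue measure) and norm $\|\cdot\|$; $\mathfrak{R}(L^2)$ is the algebra of bounded linear operators $L^2\to L^2$, with operator norm also denoted $\|\cdot\|$. For a Banach space $B$ and $k\in\mathbb{N}$, $C(\mathbb{R}^k,B)$ is the Banach space, with the sup-norm, of continuous functions $f:\mathbb{R}^k\to B$ with $\|f(x)\|_B\to0$ as $|x|\to\infty$. A set in a normed space $Y$ is relatively compact if each sequence of its elements contains a subsequence converging in the norm of $Y$; a sequence is relatively compact if the set of its values is. $K^0$-kernels: a measurable function $\boldsymbol{K}:\mathbb{R}^2\to\mathbb{C}$, square integrable in each variable for almost every value of the other, is a $K^0$-kernel if (i) $\boldsymbol{K}\in C(\mathbb{R}^2,\mathbb{C})$; (ii) the Carleman function $\boldsymbol{k}(s)=\overline{\boldsymbol{K}(s,\cdot)}$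 is in $C(\mathbb{R},L^2)$; (iii) the Carleman function $\boldsymbol{k}'(s)=\boldsymbol{K}(\cdot,s)$ is in $C(\mathbb{R},L^2)$. A kernel $\boldsymbol{K}$ induces (is the kernel of) $K\in\mathfrak{R}(L^2)$ if $(Kf)(s)=\int\boldsymbol{K}(s,t)f(t)\,dt$ for every $f\in L^2$ and almost every $s$. Standing assumptions: $\boldsymbol{T}$ is a $K^0$-kernel inducing an operator $T\in\mathfrak{R}(L^2)$, and there are positive reals $\tau_n$ ($n\in\mathbb{N}$), strictly increasing to $\infty$, such that, with $\chi_n$ the characteristic function of $(-\tau_n,\tau_n)$ and $P_nf=\chi_nf$, for each $n$ the subkernels $\boldsymbol{T}_n(s,t)=\chi_n(s)\boldsymbol{T}(s,t)$ and $\widetilde{\boldsymbol{T}}_n(s,t)=\chi_n(s)\boldsymbol{T}(s,t)\chi_n(t)$ are $K^0$-kernels and the operators they induce, $T_n=P_nT$ and $\widetilde{T}_n=P_nTP_n$, are nuclear. For $S\in\mathfrak{R}(L^2)$, $\Pi(S)$ (regular values) is the set of $\lambda\in\mathbb{C}$ for which $I-\lambda S$ has an inverse in $\mathfrak{R}(L^2)$; for $\lambda\in\Pi(S)$ the Fredholm resolvent is $S_{|\lambda}=S(I-\lambda S)^{-1}$. If $S$ is induced by a $K^0$-kernel $\boldsymbol{S}$ and $\lambda\in\Pi(S)$, the resolvent kernel $\boldsymbol{S}_{|\lambda}$ is the (existing and unique) $K^0$-kernel inducing $S_{|\lambda}$; in particular $\boldsymbol{T}_{n|\lambda}$ is the resolvent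 kernel for $\boldsymbol{T}_n$ at $\lambda$. For a sequence $\{S_n\}$ in $\mathfrak{R}(L^2)$, $\nabla_{\mathfrak b}(\{S_n\})$ is the set of all non-zero $\zeta\in\mathbb{C}$ for which there are positive constants $M(\zeta),N(\zeta)$ such that $\zeta\in\Pi(S_n)$ and $\|S_{n|\zeta}\|\le M(\zeta)$ for all $n>N(\zeta)$. *)

theory Defs
  imports "HOL-Analysis.Analysis"
begin

definition square_integrable :: "(real \<Rightarrow> complex) \<Rightarrow> bool" where
  "square_integrable f \<longleftrightarrow>
     f \<in> borel_measurable lborel \<and> integrable lborel (\<lambda>s. (cmod (f s))\<^sup>2)"

lemma square_integrable_zero: "square_integrable (\<lambda>_. 0)"
  by (simp add: square_integrable_def)

lemma square_integrable_mult_cnj: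
  assumes "square_integrable f" "square_integrable g"
  shows "integrable lborel (\<lambda>s. f s * cnj (g s))"
proof (rule Bochner_Integration.integrable_bound)
  show "integrable lborel (\<lambda>s. (cmod (f s))\<^sup>2 + (cmod (g s))\<^sup>2)"
    using assms by (auto simp: square_integrable_def)
  show "(\<lambda>s. f s * cnj (g s)) \<in> borel_measurable lborel"
  proof (rule borel_measurable_times)
    show "f \<in> borel_measurable lborel"
      using assms(1) by (simp add: square_integrable_def)
    have "cnj \<in> borel_measurable borel"
      by (intro borel_measurable_continuous_onI continuous_intros)
    then show "(\<lambda>s. cnj (g s)) \<in> borel_measurable lborel"
      using assms(2) measurable_compose[of g lborel borel cnj borel]
      by (simp add: square_integrable_def)
  qed
  have "a * b \<le> a\<^sup>2 + b\<^sup>2" if "a \<ge> 0" "b \<ge> 0" for a b :: real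
  proof -
    have "2 * a * b \<le> a\<^sup>2 + b\<^sup>2" by (rule sum_squares_bound)
    moreover have "0 \<le> a * b" using that by simp
    ultimately show ?thesis by linarith
  qed
  then show "AE s in lborel. norm (f s * cnj (g s)) \<le> norm ((cmod (f s))\<^sup>2 + (cmod (g s))\<^sup>2)"
    by (auto simp: norm_mult)
qed

lemma square_integrable_mult:
  assumes "square_integrable f" "h \<in> borel_measurable lborel" "\<And>s. cmod (h s) \<le> C"
  shows "square_integrable (\<lambda>s. h s * f s)"
  unfolding square_integrable_def
proof
  show meas: "(\<lambda>s. h s * f s) \<in> borel_measurable lborel"
    using assms by (auto simp: square_integrable_def)
  show "integrable lborel (\<lambda>s. (cmod (h s * f s))\<^sup>2)"
  proof (rule Bochner_Integration.integrable_bound)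
    show "integrable lborel (\<lambda>s. C\<^sup>2 * (cmod (f s))\<^sup>2)"
      using assms(1) by (auto simp: square_integrable_def)
    show "(\<lambda>s. (cmod (h s * f s))\<^sup>2) \<in> borel_measurable lborel"
      using meas by measurable
    show "AE s in lborel. norm ((cmod (h s * f s))\<^sup>2) \<le> norm (C\<^sup>2 * (cmod (f s))\<^sup>2)"
      using assms(3)
      by (intro AE_I2) (auto simp: norm_mult power_mult_distrib intro!: mult_right_mono power_mono)
  qed
qed

lemma square_integrable_scale: "square_integrable f \<Longrightarrow> square_integrable (\<lambda>s. c * f s)"
  by (rule square_integrable_mult[where C = "cmod c"]) auto

lemma square_integrable_add:
  assumes "square_integrable f" "square_integrable g"
  shows "square_integrable (\<lambda>s. f s + g s)"
  unfolding square_integrable_def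
proof
  show meas: "(\<lambda>s. f s + g s) \<in> borel_measurable lborel"
    using assms by (auto simp: square_integrable_def)
  show "integrable lborel (\<lambda>s. (cmod (f s + g s))\<^sup>2)"
  proof (rule Bochner_Integration.integrable_bound)
    show "integrable lborel (\<lambda>s. 2 * (cmod (f s))\<^sup>2 + 2 * (cmod (g s))\<^sup>2)"
      using assms by (auto simp: square_integrable_def)
    show "(\<lambda>s. (cmod (f s + g s))\<^sup>2) \<in> borel_measurable lborel"
      using meas by measurable
    have "(cmod (a + b))\<^sup>2 \<le> 2 * (cmod a)\<^sup>2 + 2 * (cmod b)\<^sup>2" for a b
    proof -
      have "(cmod (a + b))\<^sup>2 \<le> (cmod a + cmod b)\<^sup>2"
        by (intro power_mono norm_triangle_ineq) auto
      also have "\<dots> \<le> 2 * (cmod a)\<^sup>2 + 2 * (cmod b)\<^sup>2"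
        using sum_squares_bound[of "cmod a" "cmod b"] by (simp add: power2_sum)
      finally show ?thesis .
    qed
    then show "AE s in lborel. norm ((cmod (f s + g s))\<^sup>2)
                 \<le> norm (2 * (cmod (f s))\<^sup>2 + 2 * (cmod (g s))\<^sup>2)"
      by auto
  qed
qed

definition l2_eq :: "(real \<Rightarrow> complex) \<Rightarrow> (real \<Rightarrow> complex) \<Rightarrow> bool" where
  "l2_eq f g \<longleftrightarrow> square_integrable f \<and> square_integrable g \<and> (AE s in lborel. f s = g s)"

lemma part_equivp_l2_eq: "part_equivp l2_eq"
proof (rule part_equivpI)
  show "\<exists>f. l2_eq f f"
    using square_integrable_zero by (auto simp: l2_eq_def)
  show "symp l2_eq"
    by (auto simp: symp_def l2_eq_def)
  show "transp l2_eq"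
  proof (rule transpI)
    fix f g h assume "l2_eq f g" "l2_eq g h"
    then have "AE s in lborel. f s = g s" "AE s in lborel. g s = h s"
      by (auto simp: l2_eq_def)
    then have "AE s in lborel. f s = h s" by eventually_elim simp
    with \<open>l2_eq f g\<close> \<open>l2_eq g h\<close> show "l2_eq f h" by (auto simp: l2_eq_def)
  qed
qed

quotient_type l2 = "real \<Rightarrow> complex" / partial: l2_eq
  by (rule part_equivp_l2_eq)

lemma square_integrable_rep_l2: "square_integrable (rep_l2 f)"
  using Quotient3_rep_reflp[OF Quotient3_l2, of f] by (simp add: l2_eq_def)

lemma rep_abs_l2:
  assumes "square_integrable f"
  shows "AE s in lborel. rep_l2 (abs_l2 f) s = f s"
proof -
  have "l2_eq f f" using assms by (simp add: l2_eq_def)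
  then have "l2_eq (rep_l2 (abs_l2 f)) f"
    by (rule rep_abs_rsp_left[OF Quotient3_l2])
  then show ?thesis by (simp add: l2_eq_def)
qed

lift_definition cinner :: "l2 \<Rightarrow> l2 \<Rightarrow> complex" is
  "\<lambda>f g. LBINT s. f s * cnj (g s)"
proof -
  fix f f' g g' :: "real \<Rightarrow> complex"
  assume a: "l2_eq f f'" and b: "l2_eq g g'"
  have "AE s in lborel. f s = f' s" "AE s in lborel. g s = g' s"
    using a b by (auto simp: l2_eq_def)
  then have "AE s in lborel. f s * cnj (g s) = f' s * cnj (g' s)"
    by eventually_elim simp
  moreover have "integrable lborel (\<lambda>s. f s * cnj (g s))"
    "integrable lborel (\<lambda>s. f' s * cnj (g' s))"
    using a b by (auto simp: l2_eq_def intro: square_integrable_mult_cnj)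
  ultimately show "(LBINT s. f s * cnj (g s)) = (LBINT s. f' s * cnj (g' s))"
    by (intro integral_cong_AE) auto
qed

lift_definition scaleC :: "complex \<Rightarrow> l2 \<Rightarrow> l2" (infixr "*\<^sub>C" 75) is "\<lambda>c f s. c * f s"
  by (auto simp: l2_eq_def square_integrable_scale elim: eventually_mono)

instantiation l2 :: real_vector
begin

lift_definition zero_l2 :: l2 is "\<lambda>_. 0"
  by (simp add: l2_eq_def square_integrable_zero)

lift_definition plus_l2 :: "l2 \<Rightarrow> l2 \<Rightarrow> l2" is "\<lambda>f g s. f s + g s"
  by (auto simp: l2_eq_def square_integrable_add elim: eventually_elim2)

definition scaleR_l2 :: "real \<Rightarrow> l2 \<Rightarrow> l2" where
  "scaleR_l2 r f = complex_of_real r *\<^sub>C f"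

definition uminus_l2 :: "l2 \<Rightarrow> l2" where
  "uminus_l2 f = (- 1) *\<^sub>C f"

definition minus_l2 :: "l2 \<Rightarrow> l2 \<Rightarrow> l2" where
  "minus_l2 f g = f + (- g)"

instance
proof
  fix f g h :: l2 and a b :: real
  show "f + g + h = f + (g + h)"
    by transfer (auto simp: l2_eq_def add.assoc intro!: square_integrable_add)
  show "f + g = g + f"
    by transfer (auto simp: l2_eq_def add.commute intro!: square_integrable_add)
  show "0 + f = f"
    by transfer (auto simp: l2_eq_def)
  show "- f + f = 0"
    unfolding uminus_l2_def
    by transfer (auto simp: l2_eq_def square_integrable_zero)
  show "f - g = f + - g"
    by (rule minus_l2_def)
  show "a *\<^sub>R (f + g) = a *\<^sub>R f + a *\<^sub>R g"
    unfolding scaleR_l2_def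
    by transfer (auto simp: l2_eq_def distrib_left
                      intro!: square_integrable_add square_integrable_scale)
  show "(a + b) *\<^sub>R f = a *\<^sub>R f + b *\<^sub>R f"
    unfolding scaleR_l2_def
    by transfer (auto simp: l2_eq_def distrib_right
                      intro!: square_integrable_add square_integrable_scale)
  show "a *\<^sub>R b *\<^sub>R f = (a * b) *\<^sub>R f"
    unfolding scaleR_l2_def
    by transfer (auto simp: l2_eq_def mult.assoc intro!: square_integrable_scale)
  show "1 *\<^sub>R f = f"
    unfolding scaleR_l2_def
    by transfer (auto simp: l2_eq_def)
qed

end

instantiation l2 :: real_inner
begin

definition inner_l2 :: "l2 \<Rightarrow> l2 \<Rightarrow> real" where
  "inner_l2 f g = Re (cinner f g)"

definition norm_l2 :: "l2 \<Rightarrow> real" where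
  "norm_l2 f = sqrt (Re (cinner f f))"

definition sgn_l2 :: "l2 \<Rightarrow> l2" where
  "sgn_l2 f = f /\<^sub>R norm f"

definition dist_l2 :: "l2 \<Rightarrow> l2 \<Rightarrow> real" where
  "dist_l2 f g = norm (f - g)"

definition uniformity_l2 :: "(l2 \<times> l2) filter" where
  "uniformity_l2 = (INF e\<in>{0<..}. principal {(f, g). dist f g < e})"

definition open_l2 :: "l2 set \<Rightarrow> bool" where
  "open_l2 U \<longleftrightarrow> (\<forall>f\<in>U. eventually (\<lambda>(f', g). f' = f \<longrightarrow> g \<in> U) uniformity)"

instance
proof
  fix f g h :: l2 and a :: real and U :: "l2 set"
  show "dist f g = norm (f - g)"
    by (rule dist_l2_def)
  show "sgn f = f /\<^sub>R norm f"
    by (rule sgn_l2_def)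
  show "uniformity = (INF e\<in>{0<..}. principal {(f :: l2, g). dist f g < e})"
    by (rule uniformity_l2_def)
  show "open U \<longleftrightarrow> (\<forall>f\<in>U. eventually (\<lambda>(f', g). f' = f \<longrightarrow> g \<in> U) uniformity)"
    by (rule open_l2_def)
  show "inner f g = inner g f"
    unfolding inner_l2_def
  proof transfer
    fix f g :: "real \<Rightarrow> complex"
    have "(LBINT s. g s * cnj (f s)) = (LBINT s. cnj (f s * cnj (g s)))"
      by (simp add: mult.commute)
    also have "\<dots> = cnj (LBINT s. f s * cnj (g s))"
      by (rule Bochner_Integration.integral_cnj)
    finally show "Re (LBINT s. f s * cnj (g s)) = Re (LBINT s. g s * cnj (f s))"
      by simp
  qed
  show "inner (f + g) h = inner f h + inner g h"
    unfolding inner_l2_def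
    by transfer (auto simp: l2_eq_def distrib_right square_integrable_mult_cnj
                            Bochner_Integration.integral_add)
  show "inner (a *\<^sub>R f) g = a * inner f g"
    unfolding inner_l2_def scaleR_l2_def
    by transfer (simp add: mult.assoc)
  have sq: "(LBINT s. f s * cnj (f s)) = of_real (LBINT s. (cmod (f s))\<^sup>2)"
    for f :: "real \<Rightarrow> complex"
    by (simp only: complex_norm_square[symmetric] integral_complex_of_real)
  show "0 \<le> inner f f"
    unfolding inner_l2_def
    by transfer (simp add: sq)
  show "inner f f = 0 \<longleftrightarrow> f = 0"
    unfolding inner_l2_def
  proof transfer
    fix f :: "real \<Rightarrow> complex"
    assume "l2_eq f f"
    then have f: "square_integrable f" by (simp add: l2_eq_def)
    have "(LBINT s. (cmod (f s))\<^sup>2) = 0 \<longleftrightarrow> (AE s in lborel. (cmod (f s))\<^sup>2 = 0)"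
      using f by (intro integral_nonneg_eq_0_iff_AE) (auto simp: square_integrable_def)
    then show "Re (LBINT s. f s * cnj (f s)) = 0 \<longleftrightarrow> l2_eq f (\<lambda>_. 0)"
      using f by (simp add: sq l2_eq_def square_integrable_zero)
  qed
  show "norm f = sqrt (inner f f)"
    by (simp add: norm_l2_def inner_l2_def)
qed

end

lemma norm_l2_abs:
  assumes "square_integrable f"
  shows "norm (abs_l2 f) = sqrt (LBINT s. (cmod (f s))\<^sup>2)"
proof -
  have "l2_eq f f" using assms by (simp add: l2_eq_def)
  then have "cinner (abs_l2 f) (abs_l2 f) = (LBINT s. f s * cnj (f s))"
    by (simp add: cinner.abs_eq)
  then show ?thesis
    by (simp only: norm_l2_def complex_norm_square[symmetric] integral_complex_of_real Re_complex_of_real)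
qed

lemma norm_l2_mult_le:
  assumes f: "square_integrable f" and h: "h \<in> borel_measurable lborel" "\<And>s. cmod (h s) \<le> C"
  shows "norm (abs_l2 (\<lambda>s. h s * f s)) \<le> norm (abs_l2 f) * C"
proof -
  have C: "0 \<le> C" using h(2)[of 0] norm_ge_zero order_trans by blast
  have sq: "square_integrable (\<lambda>s. h s * f s)"
    by (rule square_integrable_mult[OF f h])
  have "(LBINT s. (cmod (h s * f s))\<^sup>2) \<le> (LBINT s. C\<^sup>2 * (cmod (f s))\<^sup>2)"
    using sq f h
    by (intro integral_mono)
       (auto simp: square_integrable_def norm_mult power_mult_distrib
             intro!: mult_right_mono power_mono)
  also have "\<dots> = C\<^sup>2 * (LBINT s. (cmod (f s))\<^sup>2)" by simp
  finally have "sqrt (LBINT s. (cmod (h s * f s))\<^sup>2) \<le> sqrt (C\<^sup>2 * (LBINT s. (cmod (f s))\<^sup>2))"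
    by (rule real_sqrt_le_mono)
  then show ?thesis
    using C f sq by (simp add: norm_l2_abs real_sqrt_mult mult.commute)
qed

text \<open>The type \<^typ>\<open>l2 \<Rightarrow>\<^sub>L l2\<close> consists of the real-linear bounded
  operators, so the algebra of bounded complex-linear operators is a proper subset; the operator
  norm is the same.\<close>

definition bounded_ops :: "(l2 \<Rightarrow>\<^sub>L l2) set" where
  "bounded_ops = {A. \<forall>c f. blinfun_apply A (c *\<^sub>C f) = c *\<^sub>C blinfun_apply A f}"

lift_definition scaleC_op :: "complex \<Rightarrow> l2 \<Rightarrow>\<^sub>L l2" is scaleC
proof (rule bounded_linear_intro)
  fix c :: complex and f g :: l2 and r :: real
  show "c *\<^sub>C (f + g) = c *\<^sub>C f + c *\<^sub>C g"
    by transfer (auto simp: l2_eq_def distrib_left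
                      intro!: square_integrable_add square_integrable_scale)
  show "c *\<^sub>C r *\<^sub>R f = r *\<^sub>R c *\<^sub>C f"
    unfolding scaleR_l2_def
    by transfer (auto simp: l2_eq_def mult.left_commute intro!: square_integrable_scale)
  obtain f' where f': "f = abs_l2 f'" "square_integrable f'"
    by (metis Quotient3_abs_rep[OF Quotient3_l2] square_integrable_rep_l2)
  then have "c *\<^sub>C f = abs_l2 (\<lambda>s. c * f' s)"
    by (simp add: scaleC.abs_eq l2_eq_def)
  then show "norm (c *\<^sub>C f) \<le> norm f * cmod c"
    using norm_l2_mult_le[of f' "\<lambda>_. c" "cmod c"] f' by simp
qed

definition scale_op :: "complex \<Rightarrow> (l2 \<Rightarrow>\<^sub>L l2) \<Rightarrow> (l2 \<Rightarrow>\<^sub>L l2)" where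
  "scale_op c A = scaleC_op c o\<^sub>L A"

definition cutoff :: "real \<Rightarrow> real \<Rightarrow> complex" where
  "cutoff r s = indicator {- r<..<r} s"

lemma measurable_cutoff: "cutoff r \<in> borel_measurable lborel"
  unfolding cutoff_def[abs_def] by measurable

lemma norm_cutoff_le: "cmod (cutoff r s) \<le> 1"
  by (simp add: cutoff_def indicator_def)

lift_definition cutoff_l2 :: "real \<Rightarrow> l2 \<Rightarrow> l2" is "\<lambda>r f s. cutoff r s * f s"
  by (auto simp: l2_eq_def elim: eventually_mono
           intro!: square_integrable_mult[OF _ measurable_cutoff norm_cutoff_le])

lift_definition cutoff_op :: "real \<Rightarrow> l2 \<Rightarrow>\<^sub>L l2" is cutoff_l2
proof (rule bounded_linear_intro)
  fix r :: real and f g :: l2 and a :: real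
  show "cutoff_l2 r (f + g) = cutoff_l2 r f + cutoff_l2 r g"
    by transfer (auto simp: l2_eq_def distrib_left
        intro!: square_integrable_add square_integrable_mult[OF _ measurable_cutoff norm_cutoff_le])
  show "cutoff_l2 r (a *\<^sub>R f) = a *\<^sub>R cutoff_l2 r f"
    unfolding scaleR_l2_def
    by transfer (auto simp: l2_eq_def mult.left_commute
        intro!: square_integrable_scale square_integrable_mult[OF _ measurable_cutoff norm_cutoff_le])
  obtain f' where f': "f = abs_l2 f'" "square_integrable f'"
    by (metis Quotient3_abs_rep[OF Quotient3_l2] square_integrable_rep_l2)
  then have "cutoff_l2 r f = abs_l2 (\<lambda>s. cutoff r s * f' s)"
    by (simp add: cutoff_l2.abs_eq l2_eq_def)
  then show "norm (cutoff_l2 r f) \<le> norm f * 1"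
    using norm_l2_mult_le[of f' "cutoff r" 1] f' measurable_cutoff norm_cutoff_le by simp
qed

text \<open>The library has no nuclear operators; this is the standard definition by an absolutely
  convergent sum of rank-one operators.\<close>

definition nuclear :: "(l2 \<Rightarrow>\<^sub>L l2) \<Rightarrow> bool" where
  "nuclear A \<longleftrightarrow>
     (\<exists>x y :: nat \<Rightarrow> l2. summable (\<lambda>n. norm (x n) * norm (y n)) \<and>
        (\<forall>f. (\<lambda>n. cinner f (x n) *\<^sub>C y n) sums blinfun_apply A f))"

definition is_inverse_op :: "(l2 \<Rightarrow>\<^sub>L l2) \<Rightarrow> (l2 \<Rightarrow>\<^sub>L l2) \<Rightarrow> bool" where
  "is_inverse_op A B \<longleftrightarrow> B \<in> bounded_ops \<and> A o\<^sub>L B = id_blinfun \<and> B o\<^sub>L A = id_blinfun"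

definition inverse_op :: "(l2 \<Rightarrow>\<^sub>L l2) \<Rightarrow> (l2 \<Rightarrow>\<^sub>L l2)" where
  "inverse_op A = (THE B. is_inverse_op A B)"

definition regular_values :: "(l2 \<Rightarrow>\<^sub>L l2) \<Rightarrow> complex set" where
  "regular_values S = {z. \<exists>B. is_inverse_op (id_blinfun - scale_op z S) B}"

definition fredholm_resolvent :: "(l2 \<Rightarrow>\<^sub>L l2) \<Rightarrow> complex \<Rightarrow> (l2 \<Rightarrow>\<^sub>L l2)" where
  "fredholm_resolvent S z = S o\<^sub>L inverse_op (id_blinfun - scale_op z S)"

lemma inverse_op_unique:
  assumes "is_inverse_op A B"
  shows "inverse_op A = B"
  unfolding inverse_op_def
proof (rule the_equality)
  fix B' assume "is_inverse_op A B'"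
  then have "blinfun_apply B' (blinfun_apply A f) = f" "blinfun_apply A (blinfun_apply B f) = f" for f
    using assms by (auto simp: is_inverse_op_def dest!: arg_cong[where f = "\<lambda>C. blinfun_apply C f"])
  then show "B' = B" by (metis blinfun_eqI)
qed (fact assms)

definition nabla_b :: "(nat \<Rightarrow> (l2 \<Rightarrow>\<^sub>L l2)) \<Rightarrow> complex set" where
  "nabla_b S = {z. z \<noteq> 0 \<and>
     (\<exists>M N :: real. M > 0 \<and> N > 0 \<and>
        (\<forall>n. real n > N \<longrightarrow>
           z \<in> regular_values (S n) \<and> norm (fredholm_resolvent (S n) z) \<le> M))}"

definition C0 :: "('a::euclidean_space \<Rightarrow> 'b::real_normed_vector) set" where
  "C0 = {f. continuous_on UNIV f \<and> (f \<longlongrightarrow> 0) at_infinity}"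

lemma C0_bcontfun:
  assumes "f \<in> C0"
  shows "f \<in> bcontfun"
proof -
  have cont: "continuous_on UNIV f" using assms by (simp add: C0_def)
  have "eventually (\<lambda>x. norm (f x) < 1) at_infinity"
    using assms tendstoD[of f 0 at_infinity 1] by (simp add: C0_def)
  then obtain b where b: "\<And>x. b \<le> norm x \<Longrightarrow> norm (f x) < 1"
    by (auto simp: eventually_at_infinity)
  have "compact (f ` cball 0 b)"
    by (intro compact_continuous_image compact_cball continuous_on_subset[OF cont]) auto
  then have "bounded (f ` cball 0 b)" by (rule compact_imp_bounded)
  then obtain c where "\<forall>y\<in>f ` cball 0 b. norm y \<le> c" unfolding bounded_iff by blast
  then have c: "norm (f x) \<le> c" if "norm x \<le> b" for x using that by simp
  have "norm (f x) \<le> max 1 c" for x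
    using b[of x] c[of x] by (cases "norm x \<le> b") auto
  with cont show ?thesis by (rule bcontfun_normI)
qed

text \<open>The Banach space of such functions, realised as a subspace of the type of bounded continuous
  functions, whose norm is the sup-norm. \<open>Bcontfun f\<close> is only meaningful for bounded
  continuous \<open>f\<close>, which by \<open>C0_bcontfun\<close> includes every \<open>f \<in> C0\<close>.\<close>

definition C0_space :: "('a::euclidean_space \<Rightarrow>\<^sub>C 'b::real_normed_vector) set" where
  "C0_space = {F. apply_bcontfun F \<in> C0}"

lemma Bcontfun_C0:
  assumes "f \<in> C0"
  shows "apply_bcontfun (Bcontfun f) = f" "Bcontfun f \<in> C0_space"
  using C0_bcontfun[OF assms] assms by (simp_all add: Bcontfun_inverse C0_space_def)

definition relatively_compact_in :: "'a::real_normed_vector set \<Rightarrow> 'a set \<Rightarrow> bool" where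
  "relatively_compact_in Y A \<longleftrightarrow> A \<subseteq> Y \<and>
     (\<forall>x :: nat \<Rightarrow> 'a. range x \<subseteq> A \<longrightarrow>
        (\<exists>r l. strict_mono (r :: nat \<Rightarrow> nat) \<and> l \<in> Y \<and> (\<lambda>k. x (r k)) \<longlonglongrightarrow> l))"

text \<open>\<open>abs_l2\<close> is meaningful only on square integrable functions; hence both Carleman functions
  are required to take values in \<open>L\<^sup>2\<close> at every point.\<close>

definition K0_kernel :: "(real \<times> real \<Rightarrow> complex) \<Rightarrow> bool" where
  "K0_kernel K \<longleftrightarrow>
     K \<in> borel_measurable lborel \<and>
     (AE s in lborel. square_integrable (\<lambda>t. K (s, t))) \<and>
     (AE t in lborel. square_integrable (\<lambda>s. K (s, t))) \<and>
     K \<in> C0 \<and>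
     (\<forall>s. square_integrable (\<lambda>t. cnj (K (s, t)))) \<and>
     (\<lambda>s. abs_l2 (\<lambda>t. cnj (K (s, t)))) \<in> C0 \<and>
     (\<forall>t. square_integrable (\<lambda>s. K (s, t))) \<and>
     (\<lambda>t. abs_l2 (\<lambda>s. K (s, t))) \<in> C0"

definition induces :: "(real \<times> real \<Rightarrow> complex) \<Rightarrow> (l2 \<Rightarrow>\<^sub>L l2) \<Rightarrow> bool" where
  "induces K A \<longleftrightarrow> A \<in> bounded_ops \<and>
     (\<forall>f. AE s in lborel. rep_l2 (blinfun_apply A f) s = (LBINT t. K (s, t) * rep_l2 f t))"

definition resolvent_kernel :: "(l2 \<Rightarrow>\<^sub>L l2) \<Rightarrow> complex \<Rightarrow> (real \<times> real \<Rightarrow> complex)" where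
  "resolvent_kernel S z = (THE K. K0_kernel K \<and> induces K (fredholm_resolvent S z))"

end

theory Submission
  imports Defs "HOL-Complex_Analysis.Great_Picard"
begin

text \<open>Write \<open>T\<^sub>n = P\<^sub>n T\<close>, \<open>B\<^sub>n = (I - \<lambda>\<^sub>n T\<^sub>n)\<^sup>-\<^sup>1\<close>, and let \<open>t\<^sub>n(s) = cnj (T\<^sub>n(s,\<cdot>))\<close> and
  \<open>t'\<^sub>n(t) = T\<^sub>n(\<cdot>,t)\<close> be the Carleman functions of the kernel of \<open>T\<^sub>n\<close>. The Fredholm resolvent is
  \<open>T\<^sub>n B\<^sub>n = T\<^sub>n + \<lambda>\<^sub>n T\<^sub>n B\<^sub>n T\<^sub>n\<close>, which on the level of kernels reads

  \<open>R\<^sub>n(s,t) = T\<^sub>n(s,t) + \<lambda>\<^sub>n \<langle>B\<^sub>n t'\<^sub>n(t), t\<^sub>n(s)\<rangle>\<close>.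

  Everything on the right is controlled uniformly in \<open>n\<close>. The hypothesis on \<open>nabla_b\<close> bounds
  \<open>\<lambda>\<^sub>n T\<^sub>n B\<^sub>n = B\<^sub>n - I\<close> for large \<open>n\<close>, so the norms of all \<open>B\<^sub>n\<close> are bounded
  (\<open>nabla_b_inverse_bounded\<close>). The columns are \<open>t'\<^sub>n(t) = P\<^sub>n t'(t)\<close> with \<open>P\<^sub>n\<close> a contraction. The
  kernels \<open>T\<^sub>n\<close> and their rows \<open>t\<^sub>n\<close> are truncations of one fixed function vanishing at infinity, and
  since these truncations are continuous, the fixed function vanishes where the cut is made; the
  truncations therefore share its modulus of continuity (\<open>equi_C0_truncation\<close>). Consequently the
  \<open>R\<^sub>n\<close> are uniformly bounded, equicontinuous, and decay uniformly at infinity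
  (\<open>equi_C0_resolvent_formula\<close>), and the Arzela-Ascoli theorem applies (\<open>Arzela_Ascoli_C0\<close>).

  The remaining work is to show that the displayed formula is the resolvent kernel
  (\<open>resolvent_kernel_eq\<close>). Uniqueness of a \<open>K\<^sup>0\<close>-kernel follows from continuity
  (\<open>K0_kernel_unique\<close>). That the formula induces the resolvent and has the regularity of a
  \<open>K\<^sup>0\<close>-kernel rests on the identity \<open>\<langle>B A f, g\<rangle> = \<integral> f(t) \<langle>B k'(t), g\<rangle> dt\<close> for an operator \<open>A\<close> with
  column function \<open>k'\<close> and a bounded operator \<open>B\<close> (\<open>pairing_integral\<close>), that is, on pulling \<open>B\<close> out of
  a weak integral. It is obtained from Riemann sums for \<open>f\<close> of bounded support, then for all \<open>f\<close> by
  truncation.\<close>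

section \<open>The complex inner product\<close>

lemma abs_rep_l2 [simp]: "abs_l2 (rep_l2 f) = f"
  by (rule Quotient3_abs_rep[OF Quotient3_l2])

lemma l2_eq_refl: "square_integrable f \<Longrightarrow> l2_eq f f"
  by (simp add: l2_eq_def)

lemma abs_l2_eq_iff:
  assumes "square_integrable f" "square_integrable g"
  shows "abs_l2 f = abs_l2 g \<longleftrightarrow> (AE s in lborel. f s = g s)"
  using Quotient3_rel[OF Quotient3_l2, of f g] assms by (auto simp: l2_eq_def)

lemma abs_l2_add:
  assumes "square_integrable f" "square_integrable g"
  shows "abs_l2 (\<lambda>s. f s + g s) = abs_l2 f + abs_l2 g"
  using assms by (simp add: plus_l2.abs_eq l2_eq_refl)

lemma abs_l2_scaleC:
  assumes "square_integrable f"
  shows "abs_l2 (\<lambda>s. c * f s) = c *\<^sub>C abs_l2 f"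
  using assms by (simp add: scaleC.abs_eq l2_eq_refl)

lemma abs_l2_zero: "abs_l2 (\<lambda>s. 0) = 0"
  by (simp add: zero_l2_def)

lemma cinner_abs_l2:
  assumes "square_integrable f" "square_integrable g"
  shows "cinner (abs_l2 f) (abs_l2 g) = (LBINT s. f s * cnj (g s))"
  using assms by (simp add: cinner.abs_eq l2_eq_refl)

lemma square_integrable_measurable [measurable_dest]:
  "square_integrable f \<Longrightarrow> f \<in> borel_measurable borel"
  by (simp add: square_integrable_def)

lemma measurable_rep_l2 [measurable]: "rep_l2 f \<in> borel_measurable borel"
  using square_integrable_rep_l2[of f] by (simp add: square_integrable_def)

lemma measurable_cnj [measurable]: "cnj \<in> borel_measurable borel"
  by (intro borel_measurable_continuous_onI continuous_intros)

lemma square_integrable_cnj_iff: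
  "square_integrable (\<lambda>s. cnj (f s)) \<longleftrightarrow> square_integrable f"
proof -
  have "f \<in> borel_measurable borel" if "(\<lambda>s. cnj (f s)) \<in> borel_measurable borel"
    using measurable_compose[OF that measurable_cnj] by simp
  moreover have "(\<lambda>s. cnj (f s)) \<in> borel_measurable borel" if "f \<in> borel_measurable borel"
    using measurable_compose[OF that measurable_cnj] by simp
  ultimately have "(\<lambda>s. cnj (f s)) \<in> borel_measurable borel \<longleftrightarrow> f \<in> borel_measurable borel"
    by blast
  then show ?thesis by (simp add: square_integrable_def)
qed

lemma square_integrable_cong_AE:
  assumes "square_integrable f" "g \<in> borel_measurable borel" "AE s in lborel. f s = g s"
  shows "square_integrable g"
  unfolding square_integrable_def
proof
  have [measurable]: "f \<in> borel_measurable borel" "g \<in> borel_measurable borel"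
    using assms by (auto simp: square_integrable_def)
  show "integrable lborel (\<lambda>s. (cmod (g s))\<^sup>2)"
    using assms(1) unfolding square_integrable_def
    by (rule conjunct2[THEN integrable_cong_AE_imp]) (use assms(3) in \<open>auto elim: eventually_mono\<close>)
qed (use assms in simp)

lemma cinner_add_left: "cinner (f + g) h = cinner f h + cinner g h"
  by transfer (auto simp: l2_eq_def distrib_right square_integrable_mult_cnj
                          Bochner_Integration.integral_add)

lemma cinner_scaleC_left: "cinner (c *\<^sub>C f) g = c * cinner f g"
  by transfer (simp add: mult.assoc)

lemma cinner_commute: "cinner g f = cnj (cinner f g)"
proof transfer
  fix f g :: "real \<Rightarrow> complex"
  have "(LBINT s. g s * cnj (f s)) = (LBINT s. cnj (f s * cnj (g s)))"
    by (simp add: mult.commute)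
  also have "\<dots> = cnj (LBINT s. f s * cnj (g s))"
    by (rule Bochner_Integration.integral_cnj)
  finally show "(LBINT s. g s * cnj (f s)) = cnj (LBINT s. f s * cnj (g s))" .
qed

lemma cinner_add_right: "cinner h (f + g) = cinner h f + cinner h g"
  unfolding cinner_commute[where g=h] by (simp add: cinner_add_left)

lemma scaleC_of_real: "complex_of_real r *\<^sub>C f = r *\<^sub>R f"
  by (simp add: scaleR_l2_def)

lemma cinner_self: "cinner f f = of_real ((norm f)\<^sup>2)"
proof (rule complex_eqI)
  show "Im (cinner f f) = Im (of_real ((norm f)\<^sup>2))"
    using arg_cong[OF cinner_commute[where f=f and g=f], of Im] by (simp add: complex_eq_iff)
  show "Re (cinner f f) = Re (of_real ((norm f)\<^sup>2))"
    by (simp add: power2_norm_eq_inner inner_l2_def)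
qed

lemma norm_scaleC: "norm (c *\<^sub>C f) = cmod c * norm f"
proof -
  have "cinner (c *\<^sub>C f) (c *\<^sub>C f) = c * cnj (c * cinner f f)"
    unfolding cinner_scaleC_left cinner_commute[where g=f and f="c *\<^sub>C f"] by simp
  also have "\<dots> = of_real ((cmod c * norm f)\<^sup>2)"
    using complex_norm_square[of c] by (simp add: cinner_self power_mult_distrib)
  finally have "complex_of_real ((norm (c *\<^sub>C f))\<^sup>2) = of_real ((cmod c * norm f)\<^sup>2)"
    by (simp only: cinner_self)
  then have "(norm (c *\<^sub>C f))\<^sup>2 = (cmod c * norm f)\<^sup>2" by (simp only: of_real_eq_iff)
  then show ?thesis by (rule power2_eq_imp_eq) auto
qed

text \<open>The inner product of the underlying real Hilbert space is the real part of \<open>cinner\<close>, so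
  the complex inequality follows from the real one after rotating \<open>f\<close> by the phase that makes
  \<open>cinner f g\<close> real and nonnegative.\<close>

lemma cinner_Cauchy_Schwarz: "cmod (cinner f g) \<le> norm f * norm g"
proof (cases "cinner f g = 0")
  case False
  define c where "c = cnj (cinner f g) / cmod (cinner f g)"
  have c: "cmod c = 1" using False by (simp add: c_def norm_divide)
  have "c * cinner f g = cmod (cinner f g)"
    using False complex_norm_square[of "cinner f g"]
    by (simp add: c_def power2_eq_square field_simps)
  then have "cmod (cinner f g) = inner (c *\<^sub>C f) g"
    by (simp add: inner_l2_def cinner_scaleC_left)
  also have "\<dots> \<le> norm (c *\<^sub>C f) * norm g" by (rule norm_cauchy_schwarz)
  finally show ?thesis by (simp add: norm_scaleC c)
qed simp

lemma bounded_bilinear_cinner: "bounded_bilinear cinner"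
proof
  fix a b :: l2 and r :: real
  show "cinner (r *\<^sub>R a) b = r *\<^sub>R cinner a b"
    by (simp add: scaleR_l2_def cinner_scaleC_left scaleR_conv_of_real)
  show "cinner a (r *\<^sub>R b) = r *\<^sub>R cinner a b"
    unfolding cinner_commute[where g=a]
    by (simp add: scaleR_l2_def cinner_scaleC_left scaleR_conv_of_real)
  show "\<exists>K. \<forall>a b. norm (cinner a b) \<le> norm a * norm b * K"
    by (rule exI[of _ 1]) (simp add: cinner_Cauchy_Schwarz)
qed (simp_all add: cinner_add_left cinner_add_right)

interpretation cinner: bounded_bilinear cinner
  by (rule bounded_bilinear_cinner)

section \<open>Functions vanishing at infinity\<close>

lemma C0_imp_bounded:
  assumes "f \<in> C0"
  obtains M where "M > 0" "\<And>x. norm (f x) \<le> M"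
proof -
  have "bounded (range f)"
    using C0_bcontfun[OF assms] by (simp add: bcontfun_def)
  then show ?thesis using that unfolding bounded_pos by auto
qed

lemma C0_uniformly_continuous:
  fixes f :: "'a::euclidean_space \<Rightarrow> 'b::real_normed_vector"
  assumes "f \<in> C0" "e > 0"
  obtains d where "d > 0" "\<And>x y. dist x y < d \<Longrightarrow> dist (f x) (f y) < e"
proof -
  have "eventually (\<lambda>x. norm (f x) < e/2) at_infinity"
    using assms tendstoD[of f 0 at_infinity "e/2"] by (simp add: C0_def)
  then obtain b where b: "\<And>x. b \<le> norm x \<Longrightarrow> norm (f x) < e/2"
    by (auto simp: eventually_at_infinity)
  have "uniformly_continuous_on (cball 0 (b + 1)) f"
    using assms(1) unfolding C0_def
    by (intro compact_uniformly_continuous) (auto intro: continuous_on_subset)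
  then obtain d where d: "d > 0"
    "\<And>x y. x \<in> cball 0 (b + 1) \<Longrightarrow> y \<in> cball 0 (b + 1) \<Longrightarrow> dist y x < d \<Longrightarrow> dist (f y) (f x) < e"
    using assms(2) unfolding uniformly_continuous_on_def by metis
  show thesis
  proof (rule that[of "min d 1"])
    fix x y :: 'a assume xy: "dist x y < min d 1"
    show "dist (f x) (f y) < e"
    proof (cases "norm x \<le> b \<or> norm y \<le> b")
      case True
      have "norm x \<le> norm y + dist x y" "norm y \<le> norm x + dist x y"
        using norm_triangle_sub[of x y] norm_triangle_sub[of y x]
        by (simp_all add: dist_norm norm_minus_commute)
      with True xy have "norm x \<le> b + 1" "norm y \<le> b + 1" by auto
      then show ?thesis using d(2)[of y x] xy by simp
    next
      case False
      then have "norm (f x) < e/2" "norm (f y) < e/2" using b by auto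
      then show ?thesis using norm_triangle_ineq4[of "f x" "f y"] by (simp add: dist_norm)
    qed
  qed (use d in auto)
qed

section \<open>Carleman functions of an induced operator\<close>

text \<open>These are the functions \<open>s \<mapsto> cnj (K(s,\<cdot>))\<close> and \<open>t \<mapsto> K(\<cdot>,t)\<close> with values in \<open>L\<^sup>2\<close>. The
  conjugate in the first one turns \<open>\<integral> K(s,t) f(t) dt\<close> into an inner product with \<open>f\<close>; the name
  records the variable of the kernel that survives.\<close>

definition left_carleman :: "(real \<times> real \<Rightarrow> complex) \<Rightarrow> real \<Rightarrow> l2" where
  "left_carleman K s = abs_l2 (\<lambda>t. cnj (K (s, t)))"

definition right_carleman :: "(real \<times> real \<Rightarrow> complex) \<Rightarrow> real \<Rightarrow> l2" where
  "right_carleman K t = abs_l2 (\<lambda>s. K (s, t))"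

context
  fixes K :: "real \<times> real \<Rightarrow> complex"
  assumes K0: "K0_kernel K"
begin

lemma kernel_C0: "K \<in> C0"
  and left_carleman_C0: "left_carleman K \<in> C0"
  and right_carleman_C0: "right_carleman K \<in> C0"
  and square_integrable_row: "square_integrable (\<lambda>t. cnj (K (s, t)))"
  and square_integrable_column: "square_integrable (\<lambda>s. K (s, t))"
  using K0 by (simp_all add: K0_kernel_def left_carleman_def[abs_def] right_carleman_def[abs_def])

lemma kernel_continuous: "continuous_on UNIV K"
  using kernel_C0 by (simp add: C0_def)

lemma kernel_integral_eq_cinner:
  assumes "square_integrable f"
  shows "(LBINT t. K (s, t) * f t) = cinner (abs_l2 f) (left_carleman K s)"
  using assms square_integrable_row by (simp add: left_carleman_def cinner_abs_l2 mult.commute)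

lemma induces_AE_cinner:
  assumes "induces K A"
  shows "AE s in lborel. rep_l2 (blinfun_apply A f) s = cinner f (left_carleman K s)"
proof -
  have "AE s in lborel. rep_l2 (blinfun_apply A f) s = (LBINT t. K (s, t) * rep_l2 f t)"
    using assms by (simp add: induces_def)
  then show ?thesis
    by (simp only: kernel_integral_eq_cinner[OF square_integrable_rep_l2] abs_rep_l2)
qed

lemma continuous_right_carleman: "continuous_on UNIV (right_carleman K)"
  using right_carleman_C0 by (simp add: C0_def)

end

lemma integrable_mult_bounded:
  fixes f h :: "real \<Rightarrow> complex"
  assumes f: "integrable lborel f" and h: "h \<in> borel_measurable borel" "\<And>t. cmod (h t) \<le> C"
  shows "integrable lborel (\<lambda>t. f t * h t)"
proof (rule Bochner_Integration.integrable_bound)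
  show "integrable lborel (\<lambda>t. of_real C * f t)" using f by simp
  show "(\<lambda>t. f t * h t) \<in> borel_measurable lborel" using f h by measurable
  show "AE t in lborel. cmod (f t * h t) \<le> cmod (of_real C * f t)"
  proof (rule AE_I2)
    fix t
    have "cmod (f t) * cmod (h t) \<le> cmod (f t) * \<bar>C\<bar>"
      using h(2)[of t] by (intro mult_left_mono) auto
    then show "cmod (f t * h t) \<le> cmod (of_real C * f t)" by (simp add: norm_mult mult.commute)
  qed
qed

text \<open>The image of \<open>f\<close> is the weak integral of \<open>f(t) K(\<cdot>,t)\<close>. This is Fubini's theorem, and
  integrability of \<open>f\<close> is what makes the double integral absolutely convergent: a Carleman kernel
  need not stay an operator kernel when it is replaced by its absolute value, but the columns are
  uniformly bounded in \<open>L\<^sup>2\<close>.\<close>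

lemma induced_weak_integral:
  assumes K0: "K0_kernel K" and A: "induces K A"
    and f: "square_integrable f" "integrable lborel f"
  shows "cinner (blinfun_apply A (abs_l2 f)) g = (LBINT t. f t * cinner (right_carleman K t) g)"
proof -
  have [measurable]: "f \<in> borel_measurable borel" "K \<in> borel_measurable borel"
    using f(1) borel_measurable_continuous_onI[OF kernel_continuous[OF K0]]
    by (simp_all add: square_integrable_def)
  define F where "F t s = K (s, t) * f t * cnj (rep_l2 g s)" for t s
  obtain M where M: "M > 0" "\<And>t. norm (right_carleman K t) \<le> M"
    using C0_imp_bounded[OF right_carleman_C0[OF K0]] by blast
  have col: "square_integrable (\<lambda>s. K (s, t))" for t
    by (rule square_integrable_column[OF K0])
  have [measurable]: "K \<in> borel_measurable (borel \<Otimes>\<^sub>M borel)"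
    by (simp add: borel_prod)
  have [measurable]: "case_prod F \<in> borel_measurable (lborel \<Otimes>\<^sub>M lborel)"
    unfolding F_def[abs_def] by measurable
  have inner: "integrable lborel (F t)" for t
    unfolding F_def
    using integrable_mult_right[OF square_integrable_mult_cnj[OF col square_integrable_rep_l2], of "f t"]
    by (simp add: mult_ac)
  have bound: "(LBINT s. cmod (F t s)) \<le> M * norm g * cmod (f t)" for t
  proof -
    define u where "u s = complex_of_real (cmod (K (s, t)))" for s
    define v where "v s = complex_of_real (cmod (rep_l2 g s))" for s
    have "u \<in> borel_measurable borel" "v \<in> borel_measurable borel"
      unfolding u_def[abs_def] v_def[abs_def] by measurable
    then have uv: "square_integrable u" "square_integrable v"
      using col[of t] square_integrable_rep_l2[of g]
      by (auto simp: square_integrable_def u_def v_def)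
    have nu: "norm (abs_l2 u) = norm (right_carleman K t)"
      using uv(1) col[of t] by (simp add: right_carleman_def norm_l2_abs u_def)
    have nv: "norm (abs_l2 v) = norm g"
      using uv(2) norm_l2_abs[OF square_integrable_rep_l2[of g]] by (simp add: norm_l2_abs v_def)
    have "complex_of_real (LBINT s. cmod (F t s)) = (LBINT s. of_real (cmod (F t s)))"
      by simp
    also have "\<dots> = (LBINT s. of_real (cmod (f t)) * (u s * cnj (v s)))"
      by (simp add: F_def u_def v_def norm_mult mult_ac)
    also have "\<dots> = of_real (cmod (f t)) * cinner (abs_l2 u) (abs_l2 v)"
      using uv by (simp add: cinner_abs_l2)
    finally have "cmod (complex_of_real (LBINT s. cmod (F t s))) = cmod (f t) * cmod (cinner (abs_l2 u) (abs_l2 v))"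
      by (simp only: norm_mult norm_of_real abs_norm_cancel)
    also have "\<dots> \<le> cmod (f t) * (M * norm g)"
    proof (rule mult_left_mono)
      have "cmod (cinner (abs_l2 u) (abs_l2 v)) \<le> norm (right_carleman K t) * norm g"
        using cinner_Cauchy_Schwarz[of "abs_l2 u" "abs_l2 v"] by (simp add: nu nv)
      also have "\<dots> \<le> M * norm g" using M by (intro mult_right_mono) auto
      finally show "cmod (cinner (abs_l2 u) (abs_l2 v)) \<le> M * norm g" .
    qed simp
    finally show ?thesis by (simp add: mult_ac)
  qed
  have "integrable (lborel \<Otimes>\<^sub>M lborel) (case_prod F)"
  proof (rule lborel_pair.Fubini_integrable)
    show "integrable lborel (\<lambda>x. LBINT y. norm (case_prod F (x, y)))"
    proof (rule Bochner_Integration.integrable_bound)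
      show "integrable lborel (\<lambda>t. M * norm g * cmod (f t))" using f(2) by simp
      show "AE t in lborel. norm (LBINT y. norm (case_prod F (t, y))) \<le> norm (M * norm g * cmod (f t))"
        using bound M by (intro AE_I2) (simp add: abs_mult)
    qed (measurable)
  qed (use inner in auto)
  from lborel_pair.Fubini_integral[OF this]
  have swap: "(LBINT s. LBINT t. F t s) = (LBINT t. LBINT s. F t s)" .
  have "cinner (blinfun_apply A (abs_l2 f)) g
      = (LBINT s. rep_l2 (blinfun_apply A (abs_l2 f)) s * cnj (rep_l2 g s))"
    using cinner_abs_l2[OF square_integrable_rep_l2 square_integrable_rep_l2] by simp
  also have "\<dots> = (LBINT s. LBINT t. F t s)"
  proof (rule integral_cong_AE)
    show "AE s in lborel. rep_l2 (blinfun_apply A (abs_l2 f)) s * cnj (rep_l2 g s) = (LBINT t. F t s)"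
      using induces_AE_cinner[OF K0 A, of "abs_l2 f"]
      by eventually_elim (simp add: F_def flip: kernel_integral_eq_cinner[OF K0 f(1)])
  qed measurable
  also have "\<dots> = (LBINT t. LBINT s. F t s)" by (rule swap)
  also have "\<dots> = (LBINT t. f t * cinner (right_carleman K t) g)"
  proof (rule Bochner_Integration.integral_cong)
    fix t
    have "cinner (right_carleman K t) g = cinner (abs_l2 (\<lambda>s. K (s, t))) (abs_l2 (rep_l2 g))"
      by (simp add: right_carleman_def)
    also have "\<dots> = (LBINT s. K (s, t) * cnj (rep_l2 g s))"
      by (rule cinner_abs_l2[OF col square_integrable_rep_l2])
    finally show "(LBINT s. F t s) = f t * cinner (right_carleman K t) g"
      by (simp add: F_def mult_ac flip: integral_mult_right_zero)
  qed simp
  finally show ?thesis .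
qed

section \<open>Passing a bounded operator under the weak integral\<close>

lemma square_integrable_mult_indicator:
  assumes "square_integrable f" and [measurable]: "E \<in> sets borel"
  shows "square_integrable (\<lambda>t. indicator E t * f t)"
proof (rule square_integrable_mult[OF assms(1), where C = 1])
  show "(\<lambda>t. indicator E t :: complex) \<in> borel_measurable lborel"
    by measurable
qed (auto simp: indicator_def)

lemma integrable_mult_indicator_complex:
  fixes f :: "real \<Rightarrow> complex"
  assumes "integrable lborel f" and [measurable]: "E \<in> sets borel"
  shows "integrable lborel (\<lambda>t. indicator E t * f t)"
  using integrable_mult_bounded[OF assms(1), of "indicator E" 1]
  by (simp add: mult.commute indicator_def)

lemma integrable_kernel_pairing:
  assumes K0: "K0_kernel K" and f: "integrable lborel f" and B: "bounded_linear B"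
  shows "integrable lborel (\<lambda>t. f t * cinner (B (right_carleman K t)) g)"
proof -
  have cont: "continuous_on UNIV (\<lambda>t. cinner (B (right_carleman K t)) g)"
    by (intro cinner.continuous_on continuous_intros bounded_linear.continuous_on[OF B]
        continuous_right_carleman K0)
  obtain M where M: "M > 0" "\<And>t. norm (right_carleman K t) \<le> M"
    using C0_imp_bounded[OF right_carleman_C0[OF K0]] by blast
  obtain C where C: "C > 0" "\<And>x. norm (B x) \<le> norm x * C"
    using bounded_linear.pos_bounded[OF B] by blast
  have "cmod (cinner (B (right_carleman K t)) g) \<le> M * C * norm g" for t
  proof -
    have "cmod (cinner (B (right_carleman K t)) g) \<le> norm (B (right_carleman K t)) * norm g"
      by (rule cinner_Cauchy_Schwarz)
    also have "\<dots> \<le> (M * C) * norm g"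
      using C(2)[of "right_carleman K t"] M(2)[of t] C(1)
      by (intro mult_right_mono) (auto intro: order_trans mult_right_mono)
    finally show ?thesis .
  qed
  then show ?thesis
    by (intro integrable_mult_bounded[OF f] borel_measurable_continuous_onI cont)
qed

text \<open>The weak integral representation yields a norm estimate because the difference may be tested
  against itself.\<close>

lemma norm_induced_minus_average_le:
  assumes K0: "K0_kernel K" and A: "induces K A"
    and f: "square_integrable f" "integrable lborel f"
    and near: "\<And>t. f t \<noteq> 0 \<Longrightarrow> norm (right_carleman K t - \<phi>) \<le> e"
  shows "norm (blinfun_apply A (abs_l2 f) - (LBINT t. f t) *\<^sub>C \<phi>) \<le> e * (LBINT t. cmod (f t))"
proof -
  define v where "v = blinfun_apply A (abs_l2 f) - (LBINT t. f t) *\<^sub>C \<phi>"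
  have int: "integrable lborel (\<lambda>t. f t * cinner (right_carleman K t) v)"
    using integrable_kernel_pairing[OF K0 f(2) bounded_linear_ident] .
  have "cinner v v = (LBINT t. f t * cinner (right_carleman K t) v) - (LBINT t. f t) * cinner \<phi> v"
    by (subst v_def) (simp add: cinner.diff_left cinner_scaleC_left induced_weak_integral[OF K0 A f])
  also have "\<dots> = (LBINT t. f t * cinner (right_carleman K t - \<phi>) v)"
    using int f(2) by (simp add: cinner.diff_left right_diff_distrib)
  finally have eq: "cinner v v = (LBINT t. f t * cinner (right_carleman K t - \<phi>) v)" .
  have le: "cmod (f t * cinner (right_carleman K t - \<phi>) v) \<le> e * norm v * cmod (f t)" for t
  proof (cases "f t = 0")
    case False
    have "cmod (cinner (right_carleman K t - \<phi>) v) \<le> norm (right_carleman K t - \<phi>) * norm v"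
      by (rule cinner_Cauchy_Schwarz)
    also have "\<dots> \<le> e * norm v" using near[OF False] by (intro mult_right_mono) auto
    finally show ?thesis by (simp add: norm_mult mult.commute mult_left_mono)
  qed simp
  have "(norm v)\<^sup>2 = cmod (cinner v v)" by (simp add: cinner_self norm_power)
  also have "\<dots> \<le> (LBINT t. e * norm v * cmod (f t))"
    unfolding eq using le f(2) by (intro Bochner_Integration.integral_norm_bound_integral) (auto simp: cinner.diff_left right_diff_distrib int)
  finally have *: "norm v * norm v \<le> norm v * (e * (LBINT t. cmod (f t)))"
    by (simp add: power2_eq_square mult_ac)
  show ?thesis
  proof (cases "norm v = 0")
    case True
    have "0 \<le> e * (LBINT t. cmod (f t))"
    proof (cases "\<exists>t. f t \<noteq> 0")
      case True
      then have "0 \<le> e" using near norm_ge_zero order_trans by blast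
      then show ?thesis by simp
    qed simp
    with True show ?thesis unfolding v_def[symmetric] by simp
  next
    case False
    then show ?thesis using * unfolding v_def[symmetric] by (simp add: mult_le_cancel_left)
  qed
qed

text \<open>Where the columns are nearly constant on the support of \<open>f\<close>, both sides of the desired identity
  \<open>cinner (B (A f)) g = \<integral> f(t) (cinner (B (K(\<cdot>,t))) g) dt\<close> are close to \<open>(\<integral> f) (cinner (B \<phi>) g)\<close>.
  The error is proportional to the \<open>L\<^sup>1\<close> norm of \<open>f\<close>, so errors over disjoint pieces add up to the
  same bound for the whole function.\<close>

lemma local_pairing_error:
  assumes K0: "K0_kernel K" and A: "induces K A" and B: "B \<in> bounded_ops"
    and f: "square_integrable f" "integrable lborel f"
    and near: "\<And>t. f t \<noteq> 0 \<Longrightarrow> norm (right_carleman K t - \<phi>) \<le> e"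
  shows "cmod (cinner (B (A (abs_l2 f))) g - (LBINT t. f t * cinner (B (right_carleman K t)) g))
      \<le> 2 * norm B * norm g * e * (LBINT t. cmod (f t))" (is "cmod (?P - ?Q) \<le> _")
proof -
  let ?m = "LBINT t. cmod (f t)"
  let ?c = "cinner (B ((LBINT t. f t) *\<^sub>C \<phi>)) g"
  have blin: "bounded_linear (blinfun_apply B)" by (rule blinfun.bounded_linear_right)
  have pair: "cmod (cinner (B x) g) \<le> norm B * norm g * norm x" for x
  proof -
    have "cmod (cinner (B x) g) \<le> norm (B x) * norm g" by (rule cinner_Cauchy_Schwarz)
    also have "\<dots> \<le> (norm B * norm x) * norm g" by (intro mult_right_mono norm_blinfun) auto
    finally show ?thesis by (simp add: mult_ac)
  qed
  have "?P - ?c = cinner (B (A (abs_l2 f) - (LBINT t. f t) *\<^sub>C \<phi>)) g"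
    by (simp add: blinfun.diff_right cinner.diff_left)
  then have 1: "cmod (?P - ?c) \<le> norm B * norm g * (e * ?m)"
    using pair[of "A (abs_l2 f) - (LBINT t. f t) *\<^sub>C \<phi>"]
      mult_left_mono[OF norm_induced_minus_average_le[OF K0 A f near], of "norm B * norm g"]
    by simp
  have int: "integrable lborel (\<lambda>t. f t * cinner (B (right_carleman K t)) g)"
    by (rule integrable_kernel_pairing[OF K0 f(2) blin])
  have "?c = (LBINT t. f t) * cinner (B \<phi>) g"
    using B by (simp add: bounded_ops_def cinner_scaleC_left)
  then have "?Q - ?c = (LBINT t. f t * cinner (B (right_carleman K t - \<phi>)) g)"
    using int f(2) by (simp add: blinfun.diff_right cinner.diff_left right_diff_distrib)
  also have "cmod \<dots> \<le> (LBINT t. norm B * norm g * e * cmod (f t))"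
  proof (rule Bochner_Integration.integral_norm_bound_integral)
    fix t
    show "cmod (f t * cinner (B (right_carleman K t - \<phi>)) g) \<le> norm B * norm g * e * cmod (f t)"
    proof (cases "f t = 0")
      case False
      have "cmod (cinner (B (right_carleman K t - \<phi>)) g) \<le> norm B * norm g * e"
        using pair[of "right_carleman K t - \<phi>"] near[OF False]
        by (rule order_trans[OF _ mult_left_mono]) auto
      then show ?thesis by (simp add: norm_mult mult.commute mult_left_mono)
    qed simp
  qed (use f(2) int in \<open>auto simp: blinfun.diff_right cinner.diff_left right_diff_distrib\<close>)
  finally have 2: "cmod (?Q - ?c) \<le> norm B * norm g * (e * ?m)" by (simp add: mult_ac)
  have "cmod (?P - ?Q) \<le> cmod (?P - ?c) + cmod (?Q - ?c)"
    using norm_triangle_ineq4[of "?P - ?c" "?Q - ?c"] by simp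
  with 1 2 show ?thesis by (simp add: mult_ac)
qed

text \<open>With an adjoint of \<open>B\<close> at hand this would be the weak integral formula tested against the
  adjoint's value at \<open>g\<close>. Existence of adjoints rests on completeness of \<open>L\<^sup>2\<close>; the following
  argument by Riemann sums does without it. The support of \<open>f\<close> is cut into intervals so short that the columns vary
  by less than \<open>e\<close> on each of them (uniform continuity), and the local errors are summed.\<close>

lemma pairing_bounded_support:
  assumes K0: "K0_kernel K" and A: "induces K A" and B: "B \<in> bounded_ops"
    and f: "square_integrable f" "integrable lborel f"
    and supp: "\<And>t. \<bar>t\<bar> \<ge> r \<Longrightarrow> f t = 0"
  shows "cinner (B (A (abs_l2 f))) g = (LBINT t. f t * cinner (B (right_carleman K t)) g)"
proof -
  define D where "D f = cinner (B (A (abs_l2 f))) g - (LBINT t. f t * cinner (B (right_carleman K t)) g)"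
    for f :: "real \<Rightarrow> complex"
  define C where "C = 2 * norm B * norm g"
  have C: "C \<ge> 0" by (simp add: C_def)
  have D_add: "D (\<lambda>t. u t + v t) = D u + D v"
    if "square_integrable u" "integrable lborel u" "square_integrable v" "integrable lborel v" for u v
    using that integrable_kernel_pairing[OF K0 _ blinfun.bounded_linear_right]
    by (simp add: D_def abs_l2_add blinfun.add_right cinner.add_left distrib_right)
  have small: "cmod (D f) \<le> C * e * (LBINT t. cmod (f t))" if e: "e > 0" for e
  proof -
    obtain d where d: "d > 0"
      "\<And>x y. dist x y < d \<Longrightarrow> dist (right_carleman K x) (right_carleman K y) < e"
      using C0_uniformly_continuous[OF right_carleman_C0[OF K0] e] by blast
    define h where "h = d / 2"
    have h: "h > 0" "h < d" using d by (auto simp: h_def)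
    have step: "cmod (D u) \<le> C * e * (LBINT t. cmod (u t))"
      if u: "square_integrable u" "integrable lborel u"
        "\<And>t. t \<notin> {a<..a + real j * h} \<Longrightarrow> u t = 0" for j a u
      using u
    proof (induction j arbitrary: u)
      case 0
      then have "u = (\<lambda>t. 0)" by auto
      then show ?case by (simp add: D_def abs_l2_zero cinner.zero_left)
    next
      case (Suc j)
      define b where "b = a + real j * h"
      \<comment> \<open>the last of the \<open>Suc j\<close> intervals is split off at its left endpoint \<open>b\<close>\<close>
      define v where "v t = indicator {..b} t * u t" for t
      define w where "w t = indicator {b<..} t * u t" for t
      have vw: "square_integrable v" "integrable lborel v" "square_integrable w" "integrable lborel w"
        unfolding v_def w_def
        by (auto intro!: square_integrable_mult_indicator integrable_mult_indicator_complex Suc.prems)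
      have u: "u = (\<lambda>t. v t + w t)" by (auto simp: v_def w_def indicator_def)
      have "cmod (D v) \<le> C * e * (LBINT t. cmod (v t))"
        using Suc.prems(3) by (intro Suc.IH vw) (auto simp: v_def indicator_def b_def algebra_simps)
      moreover have "cmod (D w) \<le> C * e * (LBINT t. cmod (w t))"
        unfolding D_def C_def
      proof (rule local_pairing_error[OF K0 A B vw(3,4)])
        fix t assume "w t \<noteq> 0"
        then have "t \<in> {b<..b + h}"
          using Suc.prems(3)[of t] by (auto simp: w_def indicator_def b_def algebra_simps split: if_splits)
        then have "dist t b < d" using h by (auto simp: dist_real_def)
        then show "norm (right_carleman K t - right_carleman K b) \<le> e"
          using d(2) by (auto simp: dist_norm intro: less_imp_le)
      qed
      moreover have "(LBINT t. cmod (u t)) = (LBINT t. cmod (v t)) + (LBINT t. cmod (w t))"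
      proof -
        have "cmod (u t) = cmod (v t) + cmod (w t)" for t
          by (auto simp: v_def w_def indicator_def)
        then show ?thesis using vw by simp
      qed
      moreover have "D u = D v + D w" unfolding u by (rule D_add) (fact vw)+
      ultimately show ?case
        using norm_triangle_ineq[of "D v" "D w"] by (simp add: distrib_left)
    qed
    obtain j where j: "2 * \<bar>r\<bar> \<le> real j * h"
      using reals_Archimedean3[OF h(1), THEN spec, of "2 * \<bar>r\<bar>"] less_imp_le by blast
    show ?thesis
      using j supp by (intro step[of f "- \<bar>r\<bar>" j] f) auto
  qed
  have "D f = 0"
  proof (rule ccontr)
    assume "D f \<noteq> 0"
    \<comment> \<open>the choice of \<open>e\<close> below makes the error bound smaller than \<open>cmod (D f)\<close>; the summand 1 covers \<open>m = 0\<close>\<close>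
    define m where "m = C * (LBINT t. cmod (f t))"
    have m: "m \<ge> 0" using C by (simp add: m_def)
    have "cmod (D f) \<le> m * (cmod (D f) / (2 * (m + 1)))"
      using small[of "cmod (D f) / (2 * (m + 1))"] m \<open>D f \<noteq> 0\<close> by (simp add: m_def mult_ac)
    also have "\<dots> < cmod (D f)"
    proof -
      have "m / (2 * (m + 1)) < 1" using m by (simp add: field_simps)
      then have "cmod (D f) * (m / (2 * (m + 1))) < cmod (D f) * 1"
        using \<open>D f \<noteq> 0\<close> by (intro mult_strict_left_mono) auto
      then show ?thesis by (simp add: mult_ac)
    qed
    finally show False by simp
  qed
  then show ?thesis by (simp add: D_def)
qed

lemma square_integrable_cutoff: "square_integrable (cutoff r)"
  unfolding square_integrable_def
proof
  have "(\<lambda>s. (cmod (cutoff r s))\<^sup>2) = indicator {- r<..<r}"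
    by (auto simp: cutoff_def indicator_def)
  then show "integrable lborel (\<lambda>s. (cmod (cutoff r s))\<^sup>2)"
    using emeasure_bounded_finite[of "{- r<..<r}"] by simp
qed (rule measurable_cutoff)

lemma cutoff_l2_abs: "square_integrable f \<Longrightarrow> cutoff_l2 r (abs_l2 f) = abs_l2 (\<lambda>s. cutoff r s * f s)"
  by (simp add: cutoff_l2.abs_eq l2_eq_refl)

lemma square_integrable_cutoff_mult:
  "square_integrable f \<Longrightarrow> square_integrable (\<lambda>s. cutoff r s * f s)"
  by (rule square_integrable_mult[OF _ measurable_cutoff norm_cutoff_le])

lemma integrable_cutoff_mult:
  assumes "square_integrable f"
  shows "integrable lborel (\<lambda>s. cutoff r s * f s)"
  using square_integrable_mult_cnj[OF square_integrable_cutoff, of "\<lambda>s. cnj (f s)" r] assms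
  by (simp add: square_integrable_cnj_iff)

lemma cutoff_tendsto_1: "(\<lambda>k. cutoff (real k) t) \<longlonglongrightarrow> 1"
proof (rule tendsto_eventually)
  obtain N where "real N > \<bar>t\<bar>" using reals_Archimedean2 by blast
  then have "cutoff (real k) t = 1" if "k \<ge> N" for k
    using that by (auto simp: cutoff_def indicator_def)
  then show "eventually (\<lambda>k. cutoff (real k) t = 1) sequentially"
    by (auto simp: eventually_sequentially)
qed

text \<open>Compactly supported truncations approximate every element of \<open>L\<^sup>2\<close>, by dominated convergence.\<close>

lemma cutoff_l2_tendsto:
  assumes f: "square_integrable f"
  shows "(\<lambda>k. abs_l2 (\<lambda>s. cutoff (real k) s * f s)) \<longlonglongrightarrow> abs_l2 f"
proof -
  have [measurable]: "f \<in> borel_measurable borel" "cutoff r \<in> borel_measurable borel" for r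
    using f measurable_cutoff by (simp_all add: square_integrable_def)
  define q where "q k s = (1 - cutoff (real k) s) * f s" for k s
  have q_le: "cmod (1 - cutoff r s) \<le> 1" for r s by (simp add: cutoff_def indicator_def)
  have sq: "square_integrable (q k)" for k
    unfolding q_def using q_le by (intro square_integrable_mult[OF f]) auto
  have diff: "abs_l2 f - abs_l2 (\<lambda>s. cutoff (real k) s * f s) = abs_l2 (q k)" for k
  proof -
    have "abs_l2 f = abs_l2 (\<lambda>s. cutoff (real k) s * f s + q k s)"
      by (simp add: q_def algebra_simps)
    then show ?thesis by (simp add: abs_l2_add square_integrable_cutoff_mult f sq)
  qed
  have "(\<lambda>k. LBINT s. (cmod (q k s))\<^sup>2) \<longlonglongrightarrow> integral\<^sup>L (lborel :: real measure) (\<lambda>s. 0)"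
  proof (rule Bochner_Integration.integral_dominated_convergence[where w = "\<lambda>s. (cmod (f s))\<^sup>2"])
    show "AE s in lborel. (\<lambda>k. (cmod (q k s))\<^sup>2) \<longlonglongrightarrow> 0"
    proof (rule AE_I2)
      fix s
      have "(\<lambda>k. (cmod ((1 - cutoff (real k) s) * f s))\<^sup>2) \<longlonglongrightarrow> (cmod ((1 - 1) * f s))\<^sup>2"
        by (intro tendsto_intros cutoff_tendsto_1)
      then show "(\<lambda>k. (cmod (q k s))\<^sup>2) \<longlonglongrightarrow> 0" by (simp add: q_def)
    qed
    show "AE s in lborel. norm ((cmod (q k s))\<^sup>2) \<le> (cmod (f s))\<^sup>2" for k
    proof (rule AE_I2)
      fix s
      have "cmod (q k s) \<le> cmod (f s)"
        using mult_right_mono[OF q_le[of "real k" s], of "cmod (f s)"] by (simp add: q_def norm_mult)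
      then show "norm ((cmod (q k s))\<^sup>2) \<le> (cmod (f s))\<^sup>2" by (simp add: power_mono)
    qed
    show "integrable lborel (\<lambda>s. (cmod (f s))\<^sup>2)" using f by (simp add: square_integrable_def)
    show "(\<lambda>s. (cmod (q k s))\<^sup>2) \<in> borel_measurable lborel" for k
      using square_integrable_measurable[OF sq[of k]] by simp
  qed simp
  from tendsto_real_sqrt[OF this] have "(\<lambda>k. norm (abs_l2 (q k))) \<longlonglongrightarrow> 0"
    by (simp add: norm_l2_abs sq)
  then have "(\<lambda>k. norm (abs_l2 (\<lambda>s. cutoff (real k) s * f s) - abs_l2 f)) \<longlonglongrightarrow> 0"
    by (simp add: norm_minus_commute diff)
  then show ?thesis by (simp only: LIM_zero_iff tendsto_norm_zero_iff)
qed

context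
  fixes K :: "real \<times> real \<Rightarrow> complex" and A B :: "l2 \<Rightarrow>\<^sub>L l2"
  assumes K0: "K0_kernel K" and A: "induces K A" and B: "B \<in> bounded_ops"
begin

lemma continuous_pairing: "continuous_on UNIV (\<lambda>t. cinner (B (right_carleman K t)) g)"
  by (intro cinner.continuous_on continuous_intros
      bounded_linear.continuous_on[OF blinfun.bounded_linear_right] continuous_right_carleman K0)

text \<open>Up to conjugation the function in question is the adjoint of \<open>B A\<close> applied to \<open>g\<close>, which
  explains the bound. The proof is by duality: inserting \<open>f = cutoff r \<cdot> cnj h\<close> into the pairing
  identity bounds the square of the \<open>L\<^sup>2\<close> norm of \<open>h\<close> over \<open>{-r<..<r}\<close> by a multiple of that norm
  itself, uniformly in \<open>r\<close>.\<close>

lemma pairing_square_integrable: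
  shows "square_integrable (\<lambda>t. cinner (B (right_carleman K t)) g)"
    and "norm (abs_l2 (\<lambda>t. cinner (B (right_carleman K t)) g)) \<le> norm B * norm A * norm g"
proof -
  define h where "h t = cinner (B (right_carleman K t)) g" for t
  define C where "C = norm B * norm A * norm g"
  have C: "C \<ge> 0" by (simp add: C_def)
  have cont: "continuous_on UNIV h"
    using continuous_pairing[of g] by (simp add: h_def[abs_def])
  have [measurable]: "h \<in> borel_measurable borel"
    by (rule borel_measurable_continuous_onI[OF cont])
  have "h \<in> borel_measurable borel" by measurable
  obtain M where M: "\<And>t. cmod (h t) \<le> M"
  proof -
    obtain M where M: "M > 0" "\<And>t. norm (right_carleman K t) \<le> M"
      using C0_imp_bounded[OF right_carleman_C0[OF K0]] by blast
    have "cmod (h t) \<le> norm B * M * norm g" for t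
    proof -
      have "cmod (h t) \<le> norm (B (right_carleman K t)) * norm g"
        unfolding h_def by (rule cinner_Cauchy_Schwarz)
      also have "\<dots> \<le> (norm B * M) * norm g"
        by (intro mult_right_mono order_trans[OF norm_blinfun] mult_left_mono M) auto
      finally show ?thesis .
    qed
    then show thesis by (rule that)
  qed
  have sq: "square_integrable (\<lambda>t. cutoff r t * cnj (h t))" for r
    using square_integrable_mult[OF square_integrable_cutoff[of r], of "\<lambda>t. cnj (h t)" M] M
    by (simp add: mult.commute)
  have norm_sq: "(norm (abs_l2 (\<lambda>t. cutoff r t * cnj (h t))))\<^sup>2 = (LBINT t. (cmod (cutoff r t * h t))\<^sup>2)" for r
    using sq[of r] by (simp add: norm_l2_abs norm_mult)
  have int: "integrable lborel (\<lambda>t. (cmod (cutoff r t * h t))\<^sup>2)" for r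
    using sq[of r] by (simp add: square_integrable_def norm_mult)
  have le: "(LBINT t. (cmod (cutoff r t * h t))\<^sup>2) \<le> C\<^sup>2" for r
  proof -
    define f where "f t = cutoff r t * cnj (h t)" for t
    have f: "square_integrable f" unfolding f_def by (rule sq)
    have "integrable lborel (\<lambda>t. cutoff r t * f t)" by (rule integrable_cutoff_mult[OF f])
    also have "(\<lambda>t. cutoff r t * f t) = f" by (auto simp: f_def cutoff_def indicator_def)
    finally have fi: "integrable lborel f" .
    have "complex_of_real (LBINT t. (cmod (cutoff r t * h t))\<^sup>2) = (LBINT t. of_real ((cmod (cutoff r t * h t))\<^sup>2))"
      by (rule integral_complex_of_real[symmetric])
    also have "\<dots> = (LBINT t. f t * h t)"
    proof (rule Bochner_Integration.integral_cong)
      show "complex_of_real ((cmod (cutoff r t * h t))\<^sup>2) = f t * h t" for t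
        unfolding complex_norm_square by (auto simp: f_def cutoff_def indicator_def)
    qed simp
    also have "\<dots> = cinner (B (A (abs_l2 f))) g"
      unfolding h_def
      by (rule pairing_bounded_support[OF K0 A B f fi, where r = r, symmetric])
         (auto simp: f_def cutoff_def indicator_def)
    finally have "(norm (abs_l2 f))\<^sup>2 = cmod (cinner (B (A (abs_l2 f))) g)"
    proof -
      assume "complex_of_real (LBINT t. (cmod (cutoff r t * h t))\<^sup>2) = cinner (B (A (abs_l2 f))) g"
      then have "cmod (complex_of_real ((norm (abs_l2 f))\<^sup>2)) = cmod (cinner (B (A (abs_l2 f))) g)"
        by (simp only: norm_sq f_def[abs_def])
      then show ?thesis by (simp only: norm_of_real abs_of_nonneg zero_le_power2)
    qed
    also have "\<dots> \<le> norm (B (A (abs_l2 f))) * norm g" by (rule cinner_Cauchy_Schwarz)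
    also have "\<dots> \<le> norm B * (norm A * norm (abs_l2 f)) * norm g"
      by (intro mult_right_mono order_trans[OF norm_blinfun] mult_left_mono norm_blinfun) auto
    finally have "norm (abs_l2 f) * norm (abs_l2 f) \<le> norm (abs_l2 f) * C"
      by (simp add: C_def power2_eq_square mult_ac)
    then have "norm (abs_l2 f) \<le> C" using C by (cases "norm (abs_l2 f) = 0") (auto simp: mult_le_cancel_left)
    then show ?thesis
      using norm_sq[of r] power_mono[of "norm (abs_l2 f)" C 2] by (simp add: f_def[abs_def])
  qed
  define I where "I k = (LBINT t. (cmod (cutoff (real k) t * h t))\<^sup>2)" for k
  have mono: "(cmod (cutoff (real i) t * h t))\<^sup>2 \<le> (cmod (cutoff (real j) t * h t))\<^sup>2" if "i \<le> j" for i j t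
    using that by (auto simp: cutoff_def indicator_def)
  have "incseq I"
    unfolding I_def incseq_def by (intro allI impI integral_mono int mono)
  then obtain L where L: "I \<longlonglongrightarrow> L"
    using incseq_convergent[of I "C\<^sup>2"] le unfolding I_def by blast
  have LC: "L \<le> C\<^sup>2" by (rule LIMSEQ_le_const2[OF L]) (auto simp: I_def le)
  have lim: "(\<lambda>k. (cmod (cutoff (real k) t * h t))\<^sup>2) \<longlonglongrightarrow> (cmod (1 * h t))\<^sup>2" for t
    by (intro tendsto_intros cutoff_tendsto_1)
  have conv: "integrable lborel (\<lambda>t. (cmod (h t))\<^sup>2)" "(LBINT t. (cmod (h t))\<^sup>2) = L"
    using integral_monotone_convergence_nonneg[of lborel "\<lambda>k t. (cmod (cutoff (real k) t * h t))\<^sup>2" "\<lambda>t. (cmod (h t))\<^sup>2" L]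
      int mono lim L by (auto simp: I_def[abs_def] mono_def)
  show sqh: "square_integrable (\<lambda>t. cinner (B (right_carleman K t)) g)"
    using conv(1) \<open>h \<in> borel_measurable borel\<close> by (simp add: square_integrable_def h_def[abs_def])
  show "norm (abs_l2 (\<lambda>t. cinner (B (right_carleman K t)) g)) \<le> norm B * norm A * norm g"
    using conv(2) LC C real_sqrt_le_mono[OF LC]
    by (simp add: norm_l2_abs[OF sqh] h_def[abs_def] C_def[symmetric])
qed

text \<open>Now that the pairing is known to be in \<open>L\<^sup>2\<close>, both sides are continuous in \<open>f\<close>, so bounded
  support may be dropped.\<close>

lemma pairing_integral:
  assumes f: "square_integrable f"
  shows "cinner (B (A (abs_l2 f))) g = (LBINT t. f t * cinner (B (right_carleman K t)) g)"
proof -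
  define h where "h t = cinner (B (right_carleman K t)) g" for t
  have h: "square_integrable h" unfolding h_def by (rule pairing_square_integrable)
  have [measurable]: "f \<in> borel_measurable borel" "h \<in> borel_measurable borel"
     "cutoff r \<in> borel_measurable borel" for r
    using f h measurable_cutoff by (simp_all add: square_integrable_def)
  have int: "integrable lborel (\<lambda>t. f t * h t)"
    using square_integrable_mult_cnj[OF f, of "\<lambda>t. cnj (h t)"] h by (simp add: square_integrable_cnj_iff)
  have eq: "cinner (B (A (abs_l2 (\<lambda>t. cutoff (real k) t * f t)))) g = (LBINT t. cutoff (real k) t * f t * h t)" for k
    unfolding h_def
    by (rule pairing_bounded_support[OF K0 A B square_integrable_cutoff_mult[OF f] integrable_cutoff_mult[OF f],
          where r = "real k"])
       (auto simp: cutoff_def indicator_def)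
  have "(\<lambda>k. LBINT t. cutoff (real k) t * f t * h t) \<longlonglongrightarrow> (LBINT t. f t * h t)"
  proof (rule Bochner_Integration.integral_dominated_convergence[where w = "\<lambda>t. cmod (f t * h t)"])
    show "AE t in lborel. (\<lambda>k. cutoff (real k) t * f t * h t) \<longlonglongrightarrow> f t * h t"
    proof (rule AE_I2)
      fix t
      have "(\<lambda>k. cutoff (real k) t * f t * h t) \<longlonglongrightarrow> 1 * f t * h t"
        by (intro tendsto_intros cutoff_tendsto_1)
      then show "(\<lambda>k. cutoff (real k) t * f t * h t) \<longlonglongrightarrow> f t * h t" by simp
    qed
    show "AE t in lborel. norm (cutoff (real k) t * f t * h t) \<le> cmod (f t * h t)" for k
      by (intro AE_I2) (simp add: cutoff_def indicator_def)
  qed (use int in auto)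
  moreover have "(\<lambda>k. cinner (B (A (abs_l2 (\<lambda>t. cutoff (real k) t * f t)))) g) \<longlonglongrightarrow> cinner (B (A (abs_l2 f))) g"
    by (intro cinner.tendsto tendsto_const blinfun.tendsto cutoff_l2_tendsto f)
  ultimately show ?thesis
    unfolding eq h_def by (rule LIMSEQ_unique[symmetric])
qed

end

section \<open>Relative compactness in the space of functions vanishing at infinity\<close>

text \<open>The condition of the Arzela-Ascoli theorem on a non-compact space: uniform boundedness, uniform
  equicontinuity, and uniform decay at infinity. A constant family satisfies it iff its member is in
  \<open>C0\<close>, so the closure properties below also serve single functions.\<close>

definition equi_C0 :: "('i \<Rightarrow> 'a::euclidean_space \<Rightarrow> 'b::real_normed_vector) \<Rightarrow> bool" where
  "equi_C0 F \<longleftrightarrow>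
     (\<exists>M>0. \<forall>n x. norm (F n x) \<le> M) \<and>
     (\<forall>e>0. \<exists>d>0. \<forall>n x y. dist x y < d \<longrightarrow> dist (F n x) (F n y) < e) \<and>
     (\<forall>e>0. \<exists>r. \<forall>n x. r \<le> norm x \<longrightarrow> norm (F n x) < e)"

lemma equi_C0_bounded:
  assumes "equi_C0 F" obtains M where "M > 0" "\<And>n x. norm (F n x) \<le> M"
proof -
  have "\<exists>M>0. \<forall>n x. norm (F n x) \<le> M" using assms by (simp add: equi_C0_def)
  then show thesis using that by blast
qed

lemma equi_C0_equicontinuous:
  assumes "equi_C0 F" "e > 0"
  obtains d where "d > 0" "\<And>n x y. dist x y < d \<Longrightarrow> dist (F n x) (F n y) < e"
proof -
  have "\<exists>d>0. \<forall>n x y. dist x y < d \<longrightarrow> dist (F n x) (F n y) < e"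
    using assms by (simp add: equi_C0_def)
  then show thesis using that by blast
qed

lemma equi_C0_vanishing:
  assumes "equi_C0 F" "e > 0"
  obtains r where "\<And>n x. r \<le> norm x \<Longrightarrow> norm (F n x) < e"
proof -
  have "\<exists>r. \<forall>n x. r \<le> norm x \<longrightarrow> norm (F n x) < e" using assms by (simp add: equi_C0_def)
  then show thesis using that by blast
qed

lemma C0_vanishing:
  assumes "f \<in> C0" "e > 0"
  obtains r where "\<And>x. r \<le> norm x \<Longrightarrow> norm (f x) < e"
proof -
  have "eventually (\<lambda>x. dist (f x) 0 < e) at_infinity"
    using assms by (intro tendstoD) (auto simp: C0_def)
  then show thesis using that by (auto simp: eventually_at_infinity)
qed

lemma equi_C0_const:
  assumes "f \<in> C0"
  shows "equi_C0 (\<lambda>_. f)"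
  unfolding equi_C0_def
proof (intro conjI allI impI)
  show "\<exists>M>0. \<forall>n x. norm (f x) \<le> M" using C0_imp_bounded[OF assms] by metis
next
  fix e :: real assume "e > 0"
  then show "\<exists>d>0. \<forall>n x y. dist x y < d \<longrightarrow> dist (f x) (f y) < e"
    using C0_uniformly_continuous[OF assms] by metis
next
  fix e :: real assume "e > 0"
  then show "\<exists>r. \<forall>n x. r \<le> norm x \<longrightarrow> norm (f x) < e"
    using C0_vanishing[OF assms] by metis
qed

lemma equi_C0_imp_C0:
  assumes "equi_C0 F"
  shows "F n \<in> C0"
  unfolding C0_def
proof (intro CollectI conjI)
  show "continuous_on UNIV (F n)"
    unfolding continuous_on_iff
    by (metis equi_C0_equicontinuous[OF assms])
  show "(F n \<longlongrightarrow> 0) at_infinity"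
    unfolding tendsto_iff eventually_at_infinity
    by (metis equi_C0_vanishing[OF assms] dist_0_norm dist_commute)
qed

lemma equi_C0_reindex: "equi_C0 F \<Longrightarrow> equi_C0 (\<lambda>k. F (m k))"
  unfolding equi_C0_def by meson

lemma equi_C0_add:
  assumes F: "equi_C0 F" and G: "equi_C0 G"
  shows "equi_C0 (\<lambda>n x. F n x + G n x)"
  unfolding equi_C0_def
proof (intro conjI allI impI)
  obtain M N where "M > 0" "N > 0" "\<And>n x. norm (F n x) \<le> M" "\<And>n x. norm (G n x) \<le> N"
    using equi_C0_bounded[OF F] equi_C0_bounded[OF G] by metis
  then show "\<exists>M>0. \<forall>n x. norm (F n x + G n x) \<le> M"
    by (intro exI[of _ "M + N"]) (auto intro: norm_triangle_mono)
next
  fix e :: real assume "e > 0"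
  then have e: "e / 2 > 0" by simp
  obtain d where d: "d > 0" "\<And>n x y. dist x y < d \<Longrightarrow> dist (F n x) (F n y) < e / 2"
    using equi_C0_equicontinuous[OF F e] by metis
  obtain d' where d': "d' > 0" "\<And>n x y. dist x y < d' \<Longrightarrow> dist (G n x) (G n y) < e / 2"
    using equi_C0_equicontinuous[OF G e] by metis
  have "dist (F n x + G n x) (F n y + G n y) < e" if "dist x y < min d d'" for n x y
    using dist_triangle_add[of "F n x" "G n x" "F n y" "G n y"] d(2)[of x y n] d'(2)[of x y n] that by simp
  then show "\<exists>d>0. \<forall>n x y. dist x y < d \<longrightarrow> dist (F n x + G n x) (F n y + G n y) < e"
    using d(1) d'(1) by (intro exI[of _ "min d d'"]) auto
next
  fix e :: real assume "e > 0"
  then have e: "e / 2 > 0" by simp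
  obtain r where r: "\<And>n x. r \<le> norm x \<Longrightarrow> norm (F n x) < e / 2"
    using equi_C0_vanishing[OF F e] by metis
  obtain r' where r': "\<And>n x. r' \<le> norm x \<Longrightarrow> norm (G n x) < e / 2"
    using equi_C0_vanishing[OF G e] by metis
  have "norm (F n x + G n x) < e" if "max r r' \<le> norm x" for n x
    using norm_triangle_ineq[of "F n x" "G n x"] r[of x n] r'[of x n] that by simp
  then show "\<exists>r. \<forall>n x. r \<le> norm x \<longrightarrow> norm (F n x + G n x) < e" by blast
qed

lemma equi_C0_linear:
  assumes F: "equi_C0 F" and L: "\<And>n. linear (L n)" "\<And>n x. norm (L n x) \<le> C * norm x"
  shows "equi_C0 (\<lambda>n x. L n (F n x))"
  unfolding equi_C0_def
proof (intro conjI allI impI)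
  define D where "D = \<bar>C\<bar> + 1"
  have D: "D > 0" "norm (L n x) \<le> D * norm x" for n x
  proof -
    show "D > 0" by (simp add: D_def)
    have "C * norm x \<le> D * norm x" by (intro mult_right_mono) (auto simp: D_def)
    then show "norm (L n x) \<le> D * norm x" using L(2)[of n x] by linarith
  qed
  obtain M where M: "M > 0" "\<And>n x. norm (F n x) \<le> M" using equi_C0_bounded[OF F] by metis
  have "norm (L n (F n x)) \<le> D * M" for n x
    by (rule order_trans[OF D(2) mult_left_mono]) (use M(2) D(1) in auto)
  then show "\<exists>M>0. \<forall>n x. norm (L n (F n x)) \<le> M"
    using D(1) M(1) by (intro exI[of _ "D * M"]) auto
  have less: "norm (L n x) < e" if "norm x < e / D" for n x e
    using D(2)[of n x] that D(1) by (simp add: field_simps)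
  fix e :: real assume "e > 0"
  then have e: "e / D > 0" using D by simp
  obtain d where d: "d > 0" "\<And>n x y. dist x y < d \<Longrightarrow> dist (F n x) (F n y) < e / D"
    using equi_C0_equicontinuous[OF F e] by metis
  have "dist (L n (F n x)) (L n (F n y)) < e" if "dist x y < d" for n x y
    using less d(2)[OF that] by (simp add: dist_norm flip: linear_diff[OF L(1)])
  then show "\<exists>d>0. \<forall>n x y. dist x y < d \<longrightarrow> dist (L n (F n x)) (L n (F n y)) < e"
    using d(1) by blast
  obtain r where r: "\<And>n x. r \<le> norm x \<Longrightarrow> norm (F n x) < e / D"
    using equi_C0_vanishing[OF F e] by metis
  then show "\<exists>r. \<forall>n x. r \<le> norm x \<longrightarrow> norm (L n (F n x)) < e" using less by blast
qed

text \<open>Cutting off a function in \<open>C0\<close> usually destroys continuity. If all truncations nevertheless are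
  continuous, they inherit the modulus of continuity of \<open>u\<close>, whatever the sets are on which they cut
  off: on a segment from a point where \<open>F n = u\<close> to a point where \<open>F n = 0\<close>, connectedness yields a
  point where both hold, so \<open>u\<close> vanishes there.\<close>

lemma equi_C0_truncation:
  assumes u: "u \<in> C0" and cont: "\<And>n. continuous_on UNIV (F n)"
    and trunc: "\<And>n x. F n x = u x \<or> F n x = 0"
  shows "equi_C0 F"
proof -
  have le: "norm (F n x) \<le> norm (u x)" for n x using trunc[of n x] by auto
  have equi: "dist (F n x) (F n y) < e"
    if e: "e > 0" and d: "\<And>x y. dist x y < d \<Longrightarrow> dist (u x) (u y) < e" and xy: "dist x y < d" for n x y d e
  proof -
    have one_sided: "dist (u x) 0 < e"
      if Fx: "F n x = u x" and Fy: "F n y = 0" and xy: "dist x y < d" for x y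
    proof -
      define S where "S = closed_segment x y"
      define P where "P = {z. F n z = u z}"
      define Q where "Q = {z. F n z = 0}"
      have "closed P" "closed Q"
        unfolding P_def Q_def using u cont by (auto intro!: closed_Collect_eq simp: C0_def)
      moreover have "S \<subseteq> P \<union> Q" using trunc by (auto simp: P_def Q_def)
      moreover have "x \<in> P \<inter> S" "y \<in> Q \<inter> S" using Fx Fy by (auto simp: P_def Q_def S_def)
      moreover have "connected S" by (simp add: S_def)
      ultimately have "P \<inter> Q \<inter> S \<noteq> {}"
        unfolding connected_closed by blast
      then obtain p where p: "p \<in> S" "u p = 0" by (auto simp: P_def Q_def)
      have "dist x p \<le> dist x y"
        using p(1) dist_in_closed_segment[of p x y] by (simp add: S_def dist_commute)
      then show ?thesis using d[of x p] xy p(2) by simp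
    qed
    consider "F n x = u x" "F n y = u y" | "F n x = u x" "F n y = 0" | "F n x = 0" "F n y = u y"
      | "F n x = 0" "F n y = 0"
      using trunc[of n x] trunc[of n y] by blast
    then show ?thesis
    proof cases
      case 1 then show ?thesis using d[OF xy] by simp
    next
      case 2 then show ?thesis using one_sided[OF 2 xy] by simp
    next
      case 3 then show ?thesis using one_sided[of y x] xy by (simp add: dist_commute)
    qed (use e in simp)
  qed
  show ?thesis
    unfolding equi_C0_def
  proof (intro conjI allI impI)
    show "\<exists>M>0. \<forall>n x. norm (F n x) \<le> M"
      using C0_imp_bounded[OF u] le order_trans by metis
  next
    fix e :: real assume "e > 0"
    then show "\<exists>d>0. \<forall>n x y. dist x y < d \<longrightarrow> dist (F n x) (F n y) < e"
      using C0_uniformly_continuous[OF u, of e] equi[of e] by metis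
  next
    fix e :: real assume "e > 0"
    then show "\<exists>r. \<forall>n x. r \<le> norm x \<longrightarrow> norm (F n x) < e"
      using C0_vanishing[OF u] le le_less_trans by metis
  qed
qed

lemma equi_C0_cinner:
  fixes F :: "'i \<Rightarrow> 'a::euclidean_space \<Rightarrow> l2" and G :: "'i \<Rightarrow> 'b::euclidean_space \<Rightarrow> l2"
  assumes F: "equi_C0 F" and G: "equi_C0 G"
  shows "equi_C0 (\<lambda>n (s, t). cinner (F n t) (G n s))"
  unfolding equi_C0_def
proof (intro conjI allI impI)
  obtain M where M: "M > 0" "\<And>n x. norm (F n x) \<le> M" using equi_C0_bounded[OF F] by metis
  obtain N where N: "N > 0" "\<And>n x. norm (G n x) \<le> N" using equi_C0_bounded[OF G] by metis
  have left: "cmod (cinner (F n t) b) \<le> M * norm b" for n t b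
    using cinner_Cauchy_Schwarz[of "F n t" b] mult_right_mono[OF M(2)[of n t], of "norm b"] by simp
  have right: "cmod (cinner a (G n s)) \<le> norm a * N" for n s a
    using cinner_Cauchy_Schwarz[of a "G n s"] mult_left_mono[OF N(2)[of n s], of "norm a"] by simp
  have "cmod (cinner (F n t) (G n s)) \<le> M * N" for n s t
    by (rule order_trans[OF left mult_left_mono]) (use N(2) M(1) in auto)
  then show "\<exists>M>0. \<forall>n x. cmod (case x of (s, t) \<Rightarrow> cinner (F n t) (G n s)) \<le> M"
    using M(1) N(1) by (intro exI[of _ "M * N"]) auto
  fix e :: real assume e: "e > 0"
  have eN: "e / (2 * N) > 0" and eM: "e / (2 * M) > 0" using e M N by simp_all
  obtain d where d: "d > 0" "\<And>n x y. dist x y < d \<Longrightarrow> dist (F n x) (F n y) < e / (2 * N)"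
    using equi_C0_equicontinuous[OF F eN] by metis
  obtain d' where d': "d' > 0" "\<And>n x y. dist x y < d' \<Longrightarrow> dist (G n x) (G n y) < e / (2 * M)"
    using equi_C0_equicontinuous[OF G eM] by metis
  have equi: "dist (cinner (F n t) (G n s)) (cinner (F n t') (G n s')) < e"
    if "dist (s, t) (s', t') < min d d'" for n s t s' t'
  proof -
    have "dist s s' < d'" "dist t t' < d"
      using that dist_fst_le[of "(s, t)" "(s', t')"] dist_snd_le[of "(s, t)" "(s', t')"] by simp_all
    then have "norm (F n t - F n t') < e / (2 * N)" "norm (G n s - G n s') < e / (2 * M)"
      using d(2)[of t t' n] d'(2)[of s s' n] by (simp_all add: dist_norm)
    then have "norm (F n t - F n t') * N < e / 2" "M * norm (G n s - G n s') < e / 2"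
      using M(1) N(1) by (simp_all add: field_simps)
    then have "cmod (cinner (F n t - F n t') (G n s)) < e / 2" "cmod (cinner (F n t') (G n s - G n s')) < e / 2"
      using right left le_less_trans by blast+
    moreover have "cinner (F n t) (G n s) - cinner (F n t') (G n s')
        = cinner (F n t - F n t') (G n s) + cinner (F n t') (G n s - G n s')"
      by (simp add: cinner.diff_left cinner.diff_right)
    ultimately show ?thesis
      using norm_triangle_ineq[of "cinner (F n t - F n t') (G n s)" "cinner (F n t') (G n s - G n s')"]
      by (simp add: dist_norm)
  qed
  show "\<exists>d>0. \<forall>n x y. dist x y < d \<longrightarrow>
      dist (case x of (s, t) \<Rightarrow> cinner (F n t) (G n s)) (case y of (s, t) \<Rightarrow> cinner (F n t) (G n s)) < e"
    by (rule exI[of _ "min d d'"]) (use d(1) d'(1) equi in auto)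
  obtain r where r: "\<And>n x. r \<le> norm x \<Longrightarrow> norm (F n x) < e / (2 * N)"
    using equi_C0_vanishing[OF F eN] by metis
  obtain r' where r': "\<And>n x. r' \<le> norm x \<Longrightarrow> norm (G n x) < e / (2 * M)"
    using equi_C0_vanishing[OF G eM] by metis
  have "cmod (cinner (F n t) (G n s)) < e" if "2 * max r r' \<le> norm (s, t)" for n s t
  proof -
    have "r \<le> norm t \<or> r' \<le> norm s" using norm_Pair_le[of s t] that by linarith
    then show ?thesis
    proof
      assume "r \<le> norm t"
      then have "norm (F n t) * N < e" using r[of t n] N(1) e by (simp add: field_simps)
      then show ?thesis using right[of "F n t" n s] by linarith
    next
      assume "r' \<le> norm s"
      then have "M * norm (G n s) < e" using r'[of s n] M(1) e by (simp add: field_simps)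
      then show ?thesis using left[of n t "G n s"] by linarith
    qed
  qed
  then show "\<exists>r. \<forall>n x. r \<le> norm x \<longrightarrow> cmod (case x of (s, t) \<Rightarrow> cinner (F n t) (G n s)) < e"
    by (intro exI[of _ "2 * max r r'"]) auto
qed

lemma closed_C0_space: "closed (C0_space :: ('a::euclidean_space \<Rightarrow>\<^sub>C 'b::real_normed_vector) set)"
  unfolding closed_sequential_limits
proof (intro allI impI, elim conjE)
  fix X and L :: "'a \<Rightarrow>\<^sub>C 'b"
  assume X: "\<forall>n. X n \<in> C0_space" and lim: "X \<longlonglongrightarrow> L"
  have "(apply_bcontfun L \<longlongrightarrow> 0) at_infinity"
  proof (rule tendstoI)
    fix e :: real assume "e > 0"
    then have e: "e / 2 > 0" by simp
    obtain n where n: "dist (X n) L < e / 2"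
      using tendstoD[OF lim e] by (auto simp: eventually_sequentially)
    have "eventually (\<lambda>x. dist (X n x) 0 < e / 2) at_infinity"
      by (rule tendstoD[OF _ e]) (use X in \<open>auto simp: C0_space_def C0_def\<close>)
    then show "eventually (\<lambda>x. dist (L x) 0 < e) at_infinity"
    proof eventually_elim
      case (elim x)
      have "dist (L x) 0 \<le> dist (L x) (X n x) + dist (X n x) 0" by (rule dist_triangle)
      also have "dist (L x) (X n x) \<le> dist L (X n)" by (rule dist_bounded)
      finally show ?case using elim n by (simp add: dist_commute)
    qed
  qed
  then show "L \<in> C0_space" by (simp add: C0_space_def C0_def)
qed

text \<open>A subsequence converges on a countable dense set. Outside a large ball all members are small,
  and inside the ball equicontinuity reduces the Cauchy condition to finitely many points of the
  dense set.\<close>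

lemma Arzela_Ascoli_C0:
  fixes F :: "nat \<Rightarrow> 'a::euclidean_space \<Rightarrow> 'b::{heine_borel, banach}"
  assumes F: "equi_C0 F"
  obtains r L where "strict_mono (r :: nat \<Rightarrow> nat)" "L \<in> C0_space" "(\<lambda>k. Bcontfun (F (r k))) \<longlonglongrightarrow> L"
proof -
  have app: "apply_bcontfun (Bcontfun (F n)) = F n" for n
    by (rule Bcontfun_C0[OF equi_C0_imp_C0[OF F]])
  obtain M where M: "\<And>n x. norm (F n x) \<le> M" using equi_C0_bounded[OF F] by metis
  obtain D :: "'a set" where D: "countable D" "\<And>X. open X \<Longrightarrow> X \<noteq> {} \<Longrightarrow> \<exists>d\<in>D. d \<in> X"
    using countable_dense_setE by blast
  obtain r where r: "strict_mono (r :: nat \<Rightarrow> nat)" "\<And>x. x \<in> D \<Longrightarrow> \<exists>l. (\<lambda>n. F (r n) x) \<longlonglongrightarrow> l"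
    using function_convergent_subsequence[OF D(1), of F M] M by metis
  have "Cauchy (\<lambda>k. Bcontfun (F (r k)))"
  proof (rule metric_CauchyI)
    fix e :: real assume "e > 0"
    then have e: "e / 4 > 0" by simp
    obtain d where d: "d > 0" "\<And>n x y. dist x y < d \<Longrightarrow> dist (F n x) (F n y) < e / 4"
      using equi_C0_equicontinuous[OF F e] by metis
    obtain b where b: "\<And>n x. b \<le> norm x \<Longrightarrow> norm (F n x) < e / 4"
      using equi_C0_vanishing[OF F e] by metis
    have "cball 0 b \<subseteq> (\<Union>c\<in>D. ball c d)"
    proof
      fix x :: 'a
      obtain c where "c \<in> D" "c \<in> ball x d" using D(2)[of "ball x d"] d(1) by auto
      then show "x \<in> (\<Union>c\<in>D. ball c d)" by (auto simp: dist_commute)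
    qed
    then obtain E where E: "E \<subseteq> D" "finite E" "cball 0 b \<subseteq> (\<Union>c\<in>E. ball c d)"
      using compactE_image[OF compact_cball, of D "\<lambda>c. ball c d" 0 b] by auto
    have "\<exists>N. \<forall>m\<ge>N. \<forall>n\<ge>N. dist (F (r m) c) (F (r n) c) < e / 4" if "c \<in> E" for c
      using r(2)[of c] that E(1) e LIMSEQ_imp_Cauchy metric_CauchyD by blast
    then obtain N where N: "\<And>c m n. c \<in> E \<Longrightarrow> N c \<le> m \<Longrightarrow> N c \<le> n \<Longrightarrow> dist (F (r m) c) (F (r n) c) < e / 4"
      by metis
    obtain K where K: "\<And>c. c \<in> E \<Longrightarrow> N c \<le> K"
      using finite_nat_set_iff_bounded_le[of "N ` E"] E(2) by auto
    have close: "dist (F (r m) x) (F (r n) x) \<le> 3 * (e / 4)" if "K \<le> m" "K \<le> n" for m n x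
    proof (cases "b \<le> norm x")
      case True
      then show ?thesis
        using b[OF True, of "r m"] b[OF True, of "r n"] e
          norm_triangle_ineq4[of "F (r m) x" "F (r n) x"] by (simp add: dist_norm)
    next
      case False
      then have "x \<in> cball 0 b" by simp
      then obtain c where c: "c \<in> E" "dist c x < d" using E(3) by (meson UN_E mem_ball subsetD)
      have "dist (F (r m) c) (F (r n) c) < e / 4"
        using N[OF c(1), of m n] K[OF c(1)] that by simp
      moreover have "dist (F (r m) x) (F (r m) c) < e / 4" "dist (F (r n) c) (F (r n) x) < e / 4"
        using d(2)[of x c "r m"] d(2)[of c x "r n"] c(2) by (simp_all add: dist_commute)
      ultimately show ?thesis
        using dist_triangle[of "F (r m) x" "F (r n) x" "F (r m) c"]
          dist_triangle[of "F (r m) c" "F (r n) x" "F (r n) c"] by linarith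
    qed
    have "dist (Bcontfun (F (r m))) (Bcontfun (F (r n))) < e" if "K \<le> m" "K \<le> n" for m n
    proof -
      have "dist (Bcontfun (F (r m))) (Bcontfun (F (r n))) \<le> 3 * (e / 4)"
        by (rule dist_bound) (use close[OF that] in \<open>simp add: app\<close>)
      then show ?thesis using \<open>e > 0\<close> by linarith
    qed
    then show "\<exists>K. \<forall>m\<ge>K. \<forall>n\<ge>K. dist (Bcontfun (F (r m))) (Bcontfun (F (r n))) < e" by blast
  qed
  then obtain L where L: "(\<lambda>k. Bcontfun (F (r k))) \<longlonglongrightarrow> L"
    using Cauchy_convergent convergentD by blast
  moreover have "L \<in> C0_space"
    by (rule closed_sequentially[OF closed_C0_space _ L]) (rule Bcontfun_C0[OF equi_C0_imp_C0[OF F]])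
  ultimately show thesis using that r(1) by blast
qed

section \<open>Resolvent kernels in closed form\<close>

text \<open>For \<open>B = (I - z A)\<^sup>-\<^sup>1\<close> the resolvent satisfies \<open>A B = A + z A B A\<close>. Since the columns of \<open>K\<close>
  are what \<open>A\<close> integrates and pairing with its rows is what \<open>A\<close> does last, \<open>A B A\<close> has the kernel
  \<open>cinner (B (K(\<cdot>,t))) (cnj (K(s,\<cdot>)))\<close>.\<close>

definition resolvent_formula ::
    "(real \<times> real \<Rightarrow> complex) \<Rightarrow> (l2 \<Rightarrow>\<^sub>L l2) \<Rightarrow> complex \<Rightarrow> real \<times> real \<Rightarrow> complex" where
  "resolvent_formula K B z = (\<lambda>(s, t). K (s, t) + z * cinner (B (right_carleman K t)) (left_carleman K s))"

lemma K0_kernelI: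
  assumes "K \<in> C0"
    and "\<And>s. square_integrable (\<lambda>t. cnj (K (s, t)))" "left_carleman K \<in> C0"
    and "\<And>t. square_integrable (\<lambda>s. K (s, t))" "right_carleman K \<in> C0"
  shows "K0_kernel K"
proof -
  have "K \<in> borel_measurable borel"
    using assms(1) by (intro borel_measurable_continuous_onI) (simp add: C0_def)
  moreover have "square_integrable (\<lambda>t. K (s, t))" for s
    using assms(2)[of s] by (simp add: square_integrable_cnj_iff)
  ultimately show ?thesis
    using assms by (simp add: K0_kernel_def left_carleman_def[abs_def] right_carleman_def[abs_def])
qed

lemma C0_linear_image:
  assumes "f \<in> C0" "bounded_linear L"
  shows "(\<lambda>x. L (f x)) \<in> C0"
proof -
  interpret bounded_linear L by fact
  show ?thesis
    using assms(1) tendsto[of f 0 at_infinity]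
    by (auto simp: C0_def zero intro: continuous_on)
qed

lemma C0_add: "f \<in> C0 \<Longrightarrow> g \<in> C0 \<Longrightarrow> (\<lambda>x. f x + g x) \<in> C0"
  using tendsto_add[of f 0 at_infinity g 0] by (auto simp: C0_def intro: continuous_intros)

lemma bounded_linear_scaleC: "bounded_linear (scaleC c)"
proof -
  have "blinfun_apply (scaleC_op c) = scaleC c" by (simp add: scaleC_op.rep_eq)
  then show ?thesis using blinfun.bounded_linear_right[of "scaleC_op c"] by simp
qed

context
  fixes K :: "real \<times> real \<Rightarrow> complex" and A B :: "l2 \<Rightarrow>\<^sub>L l2"
  assumes K0: "K0_kernel K" and A: "induces K A" and B: "B \<in> bounded_ops"
begin

text \<open>This map is the adjoint of \<open>B A\<close>. Applied to the rows of \<open>K\<close> it produces the rows of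
  the second summand of \<open>resolvent_formula\<close>, whose continuity and decay in \<open>L\<^sup>2\<close> therefore come from
  those of the rows of \<open>K\<close>.\<close>

lemma bounded_linear_cnj_pairing:
  "bounded_linear (\<lambda>g. abs_l2 (\<lambda>t. cnj (cinner (B (right_carleman K t)) g)))"
proof (rule bounded_linear_intro[where K = "norm B * norm A"])
  have sq: "square_integrable (\<lambda>t. cnj (cinner (B (right_carleman K t)) g))" for g
    using pairing_square_integrable(1)[OF K0 A B] by (simp add: square_integrable_cnj_iff)
  fix g h :: l2 and r :: real
  show "abs_l2 (\<lambda>t. cnj (cinner (B (right_carleman K t)) (g + h)))
      = abs_l2 (\<lambda>t. cnj (cinner (B (right_carleman K t)) g)) + abs_l2 (\<lambda>t. cnj (cinner (B (right_carleman K t)) h))"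
    using sq by (simp add: cinner_add_right flip: abs_l2_add)
  show "abs_l2 (\<lambda>t. cnj (cinner (B (right_carleman K t)) (r *\<^sub>R g)))
      = r *\<^sub>R abs_l2 (\<lambda>t. cnj (cinner (B (right_carleman K t)) g))"
    using abs_l2_scaleC[OF sq, of "of_real r" g]
    by (simp add: scaleC_of_real cinner.scaleR_right scaleR_conv_of_real)
  have "norm (abs_l2 (\<lambda>t. cnj (cinner (B (right_carleman K t)) g)))
      = norm (abs_l2 (\<lambda>t. cinner (B (right_carleman K t)) g))"
    using sq[of g] pairing_square_integrable(1)[OF K0 A B, of g] by (simp add: norm_l2_abs)
  then show "norm (abs_l2 (\<lambda>t. cnj (cinner (B (right_carleman K t)) g))) \<le> norm g * (norm B * norm A)"
    using pairing_square_integrable(2)[OF K0 A B, of g] by (simp add: mult.commute)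
qed

lemma resolvent_formula_C0: "resolvent_formula K B z \<in> C0"
proof -
  have "equi_C0 (\<lambda>(_::unit) t. z *\<^sub>C B (right_carleman K t))"
    by (intro equi_C0_const C0_linear_image[OF _ bounded_linear_scaleC]
        C0_linear_image[OF right_carleman_C0[OF K0]] blinfun.bounded_linear_right)
  from equi_C0_cinner[OF this equi_C0_const[OF left_carleman_C0[OF K0]]]
  have "(\<lambda>(s, t). cinner (z *\<^sub>C B (right_carleman K t)) (left_carleman K s)) \<in> C0"
    by (rule equi_C0_imp_C0)
  from C0_add[OF kernel_C0[OF K0] this] show ?thesis
    by (simp add: resolvent_formula_def cinner_scaleC_left split_def)
qed

text \<open>The columns of the second summand of \<open>resolvent_formula\<close> are the values of \<open>A\<close> at
  \<open>B (K(\<cdot>,t))\<close>, so they too are continuous in \<open>L\<^sup>2\<close>.\<close>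

lemma pairing_with_rows:
  shows "square_integrable (\<lambda>s. cinner x (left_carleman K s))"
    and "abs_l2 (\<lambda>s. cinner x (left_carleman K s)) = A x"
proof -
  have "continuous_on UNIV (\<lambda>s. cinner x (left_carleman K s))"
    using left_carleman_C0[OF K0] by (intro cinner.continuous_on continuous_intros) (simp add: C0_def)
  then have "(\<lambda>s. cinner x (left_carleman K s)) \<in> borel_measurable borel"
    by (rule borel_measurable_continuous_onI)
  then show sq: "square_integrable (\<lambda>s. cinner x (left_carleman K s))"
    using square_integrable_cong_AE[OF square_integrable_rep_l2 _ induces_AE_cinner[OF K0 A]] by blast
  have "abs_l2 (rep_l2 (A x)) = abs_l2 (\<lambda>s. cinner x (left_carleman K s))"
    using abs_l2_eq_iff[OF square_integrable_rep_l2 sq] induces_AE_cinner[OF K0 A] by blast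
  then show "abs_l2 (\<lambda>s. cinner x (left_carleman K s)) = A x" by simp
qed

lemma resolvent_formula_K0: "K0_kernel (resolvent_formula K B z)"
proof (rule K0_kernelI)
  let ?R = "resolvent_formula K B z"
  show "?R \<in> C0" by (rule resolvent_formula_C0)
  have sq: "square_integrable (\<lambda>t. cnj (cinner (B (right_carleman K t)) g))" for g
    using pairing_square_integrable(1)[OF K0 A B] by (simp add: square_integrable_cnj_iff)
  have row: "(\<lambda>t. cnj (?R (s, t))) = (\<lambda>t. cnj (K (s, t)) + cnj z * cnj (cinner (B (right_carleman K t)) (left_carleman K s)))" for s
    by (simp add: resolvent_formula_def)
  have col: "(\<lambda>s. ?R (s, t)) = (\<lambda>s. K (s, t) + z * cinner (B (right_carleman K t)) (left_carleman K s))" for t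
    by (simp add: resolvent_formula_def)
  note rows = square_integrable_row[OF K0] square_integrable_scale[OF sq]
  note cols = square_integrable_column[OF K0] square_integrable_scale[OF pairing_with_rows(1)]
  show "square_integrable (\<lambda>t. cnj (?R (s, t)))" for s
    unfolding row by (intro square_integrable_add rows)
  show "square_integrable (\<lambda>s. ?R (s, t))" for t
    unfolding col by (intro square_integrable_add cols)
  have "left_carleman ?R = (\<lambda>s. left_carleman K s
      + cnj z *\<^sub>C abs_l2 (\<lambda>t. cnj (cinner (B (right_carleman K t)) (left_carleman K s))))"
    unfolding left_carleman_def[of ?R, abs_def] row
    by (simp add: abs_l2_add[OF rows] abs_l2_scaleC[OF sq]) (simp add: left_carleman_def)
  then show "left_carleman ?R \<in> C0"
    by (auto intro!: C0_add left_carleman_C0[OF K0] C0_linear_image[OF _ bounded_linear_scaleC]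
        C0_linear_image[OF _ bounded_linear_cnj_pairing])
  have "right_carleman ?R = (\<lambda>t. right_carleman K t + z *\<^sub>C A (B (right_carleman K t)))"
    unfolding right_carleman_def[of ?R, abs_def] col
    by (simp add: abs_l2_add[OF cols] abs_l2_scaleC[OF pairing_with_rows(1)] pairing_with_rows(2))
       (simp add: right_carleman_def)
  then show "right_carleman ?R \<in> C0"
    by (auto intro!: C0_add right_carleman_C0[OF K0] C0_linear_image[OF _ bounded_linear_scaleC]
        C0_linear_image[OF _ blinfun.bounded_linear_right])
qed

lemma resolvent_formula_induces:
  assumes R: "R \<in> bounded_ops" "\<And>f. R f = A f + z *\<^sub>C A (B (A f))"
  shows "induces (resolvent_formula K B z) R"
  unfolding induces_def
proof (intro conjI allI)
  fix f
  let ?f = "rep_l2 f"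
  note sf = square_integrable_rep_l2[of f]
  have eq: "(LBINT t. resolvent_formula K B z (s, t) * ?f t)
      = cinner f (left_carleman K s) + z * cinner (B (A f)) (left_carleman K s)" for s
  proof -
    let ?h = "\<lambda>t. cinner (B (right_carleman K t)) (left_carleman K s)"
    have i1: "integrable lborel (\<lambda>t. K (s, t) * ?f t)"
      using square_integrable_mult_cnj[OF sf square_integrable_row[OF K0, of s]] by (simp add: mult.commute)
    have i2: "integrable lborel (\<lambda>t. ?f t * ?h t)"
      using square_integrable_mult_cnj[OF sf, of "\<lambda>t. cnj (?h t)"]
        pairing_square_integrable(1)[OF K0 A B, of "left_carleman K s"]
      by (simp add: square_integrable_cnj_iff)
    have "(LBINT t. resolvent_formula K B z (s, t) * ?f t) = (LBINT t. K (s, t) * ?f t + z * (?f t * ?h t))"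
      by (simp add: resolvent_formula_def algebra_simps)
    also have "\<dots> = (LBINT t. K (s, t) * ?f t) + z * (LBINT t. ?f t * ?h t)"
      using i1 i2 by simp
    also have "\<dots> = cinner f (left_carleman K s) + z * cinner (B (A f)) (left_carleman K s)"
      using pairing_integral[OF K0 A B sf, of "left_carleman K s"] kernel_integral_eq_cinner[OF K0 sf, of s]
      by simp
    finally show ?thesis .
  qed
  define x where "x = f + z *\<^sub>C B (A f)"
  have "R f = A x"
    using A by (simp add: R(2) x_def blinfun.add_right induces_def bounded_ops_def)
  then have "AE s in lborel. rep_l2 (R f) s = cinner x (left_carleman K s)"
    using induces_AE_cinner[OF K0 A, of x] by simp
  then show "AE s in lborel. rep_l2 (R f) s = (LBINT t. resolvent_formula K B z (s, t) * ?f t)"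
    by eventually_elim (simp add: eq x_def cinner_add_left cinner_scaleC_left)
qed (rule R)

end

lemma continuous_AE_eq:
  fixes f g :: "real \<Rightarrow> complex"
  assumes "continuous_on UNIV f" "continuous_on UNIV g" "AE t in lborel. f t = g t"
  shows "f t = g t"
proof -
  have "closed {t. f t = g t}" using assms by (intro closed_Collect_eq)
  moreover have "AE t in lebesgue. t \<in> {t. f t = g t}"
    using assms(3) by (auto intro: AE_completion)
  ultimately have "t \<in> {t. f t = g t}" by (rule mem_closed_if_AE_lebesgue)
  then show ?thesis by simp
qed

text \<open>The operator determines \<open>\<integral> K(s,t) f(t) dt\<close> only for almost every \<open>s\<close>, with the exceptional set
  depending on \<open>f\<close>. Continuity of the row function removes this dependence, and continuity of \<open>K\<close>
  turns equality of rows in \<open>L\<^sup>2\<close> into pointwise equality.\<close>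

lemma K0_kernel_unique:
  assumes K: "K0_kernel K" "induces K A" and L: "K0_kernel L" "induces L A"
  shows "K = L"
proof -
  have carleman: "left_carleman K s = left_carleman L s" for s
  proof -
    have "cinner f (left_carleman K s) = cinner f (left_carleman L s)" for f
    proof (rule continuous_AE_eq[where t = s])
      show "continuous_on UNIV (\<lambda>s. cinner f (left_carleman K s))"
        "continuous_on UNIV (\<lambda>s. cinner f (left_carleman L s))"
        using left_carleman_C0[OF K(1)] left_carleman_C0[OF L(1)]
        by (auto intro!: cinner.continuous_on continuous_intros simp: C0_def)
      show "AE s in lborel. cinner f (left_carleman K s) = cinner f (left_carleman L s)"
        using induces_AE_cinner[OF K, of f] induces_AE_cinner[OF L, of f] by eventually_elim simp
    qed
    then have "cinner (left_carleman K s - left_carleman L s) (left_carleman K s - left_carleman L s) = 0"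
      by (simp only: cinner.diff_right diff_self)
    then show ?thesis by (simp add: cinner_self)
  qed
  have "K (s, t) = L (s, t)" for s t
  proof (rule continuous_AE_eq[where t = t])
    show "continuous_on UNIV (\<lambda>t. K (s, t))" "continuous_on UNIV (\<lambda>t. L (s, t))"
      by (rule continuous_on_compose2[OF kernel_continuous[OF K(1)]],
          (auto intro!: continuous_intros)[2],
          rule continuous_on_compose2[OF kernel_continuous[OF L(1)]],
          auto intro!: continuous_intros)
    have "AE t in lborel. cnj (K (s, t)) = cnj (L (s, t))"
      using carleman[of s] abs_l2_eq_iff[OF square_integrable_row[OF K(1)] square_integrable_row[OF L(1)]]
      by (simp add: left_carleman_def)
    then show "AE t in lborel. K (s, t) = L (s, t)" by simp
  qed
  then show ?thesis by auto
qed

lemma resolvent_kernel_eq: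
  assumes K0: "K0_kernel K" and A: "induces K A"
    and B: "is_inverse_op (id_blinfun - scale_op z A) B"
  shows "resolvent_kernel A z = resolvent_formula K B z"
proof -
  have Bop: "B \<in> bounded_ops" using B by (simp add: is_inverse_op_def)
  have Aop: "A \<in> bounded_ops" using A by (simp add: induces_def)
  have scale: "scale_op z A f = z *\<^sub>C A f" for f
    by (simp add: scale_op_def scaleC_op.rep_eq)
  have left: "B (f - z *\<^sub>C A f) = f" for f
  proof -
    have "B o\<^sub>L (id_blinfun - scale_op z A) = id_blinfun" using B by (simp add: is_inverse_op_def)
    then have "blinfun_apply (B o\<^sub>L (id_blinfun - scale_op z A)) f = f" by simp
    then show ?thesis by (simp add: blinfun.diff_left scale)
  qed
  have Bf: "B f = f + z *\<^sub>C B (A f)" for f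
  proof -
    have "B (f - z *\<^sub>C A f) = B f - z *\<^sub>C B (A f)"
      using Bop by (simp add: blinfun.diff_right bounded_ops_def)
    with left[of f] show ?thesis by (simp add: algebra_simps)
  qed
  define R where "R = fredholm_resolvent A z"
  have R: "R = A o\<^sub>L B"
    unfolding R_def fredholm_resolvent_def inverse_op_unique[OF B] ..
  have Rop: "R \<in> bounded_ops" using Aop Bop by (simp add: R bounded_ops_def)
  have Rf: "R f = A f + z *\<^sub>C A (B (A f))" for f
  proof -
    have "R f = A (B f)" by (simp add: R)
    also have "\<dots> = A (f + z *\<^sub>C B (A f))" by (rule arg_cong[OF Bf])
    finally show ?thesis using Aop by (simp add: blinfun.add_right bounded_ops_def)
  qed
  have "K0_kernel (resolvent_formula K B z) \<and> induces (resolvent_formula K B z) R"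
    using resolvent_formula_K0[OF K0 A Bop] resolvent_formula_induces[OF K0 A Bop Rop Rf] by blast
  then show ?thesis
    unfolding resolvent_kernel_def R_def[symmetric]
    by (intro the_equality) (blast intro: K0_kernel_unique)+
qed

section \<open>Truncated kernels and their resolvents\<close>

lemma norm_cutoff_op_le: "norm (cutoff_op r f) \<le> norm f"
  using norm_l2_mult_le[OF square_integrable_rep_l2[of f] measurable_cutoff[of r] norm_cutoff_le]
    cutoff_l2_abs[OF square_integrable_rep_l2, of r f]
  by (simp add: cutoff_op.rep_eq)

lemma cutoff_op_scaleC: "cutoff_op r (c *\<^sub>C f) = c *\<^sub>C cutoff_op r f"
  unfolding cutoff_op.rep_eq
  by transfer (auto simp: l2_eq_def mult.left_commute
      intro!: square_integrable_scale square_integrable_cutoff_mult)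

lemma induces_cutoff:
  assumes A: "induces K A"
  shows "induces (\<lambda>(s, t). cutoff r s * K (s, t)) (cutoff_op r o\<^sub>L A)"
  unfolding induces_def
proof (intro conjI allI)
  show "cutoff_op r o\<^sub>L A \<in> bounded_ops"
    using A by (simp add: induces_def bounded_ops_def cutoff_op_scaleC)
  fix f
  have "cutoff_op r (A f) = abs_l2 (\<lambda>s. cutoff r s * rep_l2 (A f) s)"
    using cutoff_l2_abs[OF square_integrable_rep_l2, of r "A f"] by (simp add: cutoff_op.rep_eq)
  then have "AE s in lborel. rep_l2 (cutoff_op r (A f)) s = cutoff r s * rep_l2 (A f) s"
    using rep_abs_l2[OF square_integrable_cutoff_mult[OF square_integrable_rep_l2]] by simp
  moreover have "AE s in lborel. rep_l2 (A f) s = (LBINT t. K (s, t) * rep_l2 f t)"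
    using A by (simp add: induces_def)
  ultimately show "AE s in lborel. rep_l2 ((cutoff_op r o\<^sub>L A) f) s
      = (LBINT t. (case (s, t) of (s, t) \<Rightarrow> cutoff r s * K (s, t)) * rep_l2 f t)"
    by eventually_elim (simp add: mult.assoc)
qed

lemma right_carleman_cutoff:
  assumes K0: "K0_kernel K"
  shows "right_carleman (\<lambda>(s, t). cutoff r s * K (s, t)) t = cutoff_op r (right_carleman K t)"
  using cutoff_l2_abs[OF square_integrable_column[OF K0]]
  by (simp add: right_carleman_def cutoff_op.rep_eq)

lemma left_carleman_cutoff:
  "left_carleman (\<lambda>(s, t). cutoff r s * K (s, t)) s \<in> {left_carleman K s, 0}"
  by (simp add: left_carleman_def cutoff_def indicator_def abs_l2_zero)

lemma scale_op_1: "scale_op 1 A = A"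
proof (rule blinfun_eqI)
  have "1 *\<^sub>C f = f" for f using scaleC_of_real[of 1 f] by simp
  then show "scale_op 1 A f = A f" for f by (simp add: scale_op_def scaleC_op.rep_eq)
qed

text \<open>This holds because \<open>(I - S)\<^sup>-\<^sup>1 = I + S (I - S)\<^sup>-\<^sup>1\<close>.\<close>

lemma inverse_norm_le_resolvent:
  assumes "is_inverse_op (id_blinfun - S) B"
  shows "norm B \<le> 1 + norm (fredholm_resolvent S 1)"
proof -
  have res: "fredholm_resolvent S 1 = S o\<^sub>L B"
    using inverse_op_unique[OF assms] by (simp add: fredholm_resolvent_def scale_op_1)
  have "B = id_blinfun + (S o\<^sub>L B)"
  proof (rule blinfun_eqI)
    fix f
    have "(id_blinfun - S) o\<^sub>L B = id_blinfun" using assms by (simp add: is_inverse_op_def)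
    then have "blinfun_apply ((id_blinfun - S) o\<^sub>L B) f = f" by simp
    then show "B f = (id_blinfun + (S o\<^sub>L B)) f"
      by (simp add: blinfun.diff_left blinfun.add_left diff_eq_eq)
  qed
  then have "norm B \<le> norm (id_blinfun :: l2 \<Rightarrow>\<^sub>L l2) + norm (S o\<^sub>L B)"
    using norm_triangle_ineq[of "id_blinfun :: l2 \<Rightarrow>\<^sub>L l2" "S o\<^sub>L B"] by simp
  then show ?thesis using norm_blinfun_id_le[where 'a = l2] by (simp add: res)
qed

text \<open>Membership in \<open>nabla_b\<close> bounds all but finitely many of the inverses; the others exist by
  assumption and are covered by a maximum.\<close>

lemma nabla_b_inverse_bounded:
  assumes one: "1 \<in> nabla_b S" and B: "\<And>n. is_inverse_op (id_blinfun - S n) (B n)"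
  obtains C where "\<And>n. norm (B n) \<le> C"
proof -
  obtain M N :: real where N: "\<And>n. real n > N \<Longrightarrow> norm (fredholm_resolvent (S n) 1) \<le> M"
    using one unfolding nabla_b_def by blast
  obtain m where m: "real m > N" using reals_Archimedean2 by blast
  define C where "C = max (1 + M) (Max ((\<lambda>n. norm (B n)) ` {..m}))"
  have "norm (B n) \<le> C" for n
  proof (cases "n \<le> m")
    case True
    then have "norm (B n) \<le> Max ((\<lambda>n. norm (B n)) ` {..m})" by (intro Max_ge) auto
    then show ?thesis by (simp add: C_def)
  next
    case False
    then have "real n > N" using m by simp
    then show ?thesis using inverse_norm_le_resolvent[OF B[of n]] N[of n] by (simp add: C_def)
  qed
  then show thesis by (rule that)
qed

text \<open>The kernels \<open>\<chi>\<^sub>n(s) K(s,t)\<close> and their rows are continuous truncations of \<open>K\<close> and of its rows,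
  and the vectors entering the pairing are uniformly bounded linear images of the columns of \<open>K\<close>.
  Hence every ingredient of the formula is equicontinuous and decays uniformly.\<close>

lemma equi_C0_resolvent_formula:
  assumes K0: "K0_kernel K" and cut: "\<And>n. K0_kernel (\<lambda>(s, t). cutoff (\<tau> n) s * K (s, t))"
    and lam: "\<And>n. cmod (lam n) \<le> D" and B: "\<And>n. norm (B n) \<le> C"
  shows "equi_C0 (\<lambda>n. resolvent_formula (\<lambda>(s, t). cutoff (\<tau> n) s * K (s, t)) (B n) (lam n))"
proof -
  define Kn where "Kn n = (\<lambda>(s, t). cutoff (\<tau> n) s * K (s, t))" for n
  have Kn0: "K0_kernel (Kn n)" for n using cut by (simp add: Kn_def)
  have "equi_C0 Kn"
    by (rule equi_C0_truncation[OF kernel_C0[OF K0] kernel_continuous[OF Kn0]])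
       (auto simp: Kn_def cutoff_def indicator_def)
  have left: "equi_C0 (\<lambda>n. left_carleman (Kn n))"
  proof (rule equi_C0_truncation[OF left_carleman_C0[OF K0]])
    show "continuous_on UNIV (left_carleman (Kn n))" for n
      using left_carleman_C0[OF Kn0[of n]] by (simp add: C0_def)
    show "left_carleman (Kn n) s = left_carleman K s \<or> left_carleman (Kn n) s = 0" for n s
      using left_carleman_cutoff[of "\<tau> n" K s] by (simp add: Kn_def)
  qed
  define L where "L n x = lam n *\<^sub>C B n (cutoff_op (\<tau> n) x)" for n x
  have "linear (L n)" for n
    unfolding L_def
    by (intro bounded_linear.linear bounded_linear_compose[OF bounded_linear_scaleC]
        bounded_linear_compose[OF blinfun.bounded_linear_right] blinfun.bounded_linear_right)
  moreover have "norm (L n x) \<le> (D * C) * norm x" for n x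
  proof -
    have "norm (L n x) \<le> D * (C * norm x)"
      unfolding L_def norm_scaleC
    proof (rule mult_mono)
      have "norm (B n (cutoff_op (\<tau> n) x)) \<le> norm (B n) * norm (cutoff_op (\<tau> n) x)"
        by (rule norm_blinfun)
      also have "\<dots> \<le> C * norm x"
        using order_trans[OF norm_ge_zero B[of n]] by (intro mult_mono norm_cutoff_op_le B) auto
      finally show "norm (B n (cutoff_op (\<tau> n) x)) \<le> C * norm x" .
      show "0 \<le> D" using lam[of n] norm_ge_zero[of "lam n"] by linarith
    qed (use lam in auto)
    then show ?thesis by (simp add: mult.assoc)
  qed
  ultimately have right: "equi_C0 (\<lambda>n t. L n (right_carleman K t))"
    by (rule equi_C0_linear[OF equi_C0_const[OF right_carleman_C0[OF K0]]])
  have "resolvent_formula (Kn n) (B n) (lam n)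
      = (\<lambda>x. Kn n x + (case x of (s, t) \<Rightarrow> cinner (L n (right_carleman K t)) (left_carleman (Kn n) s)))" for n
    using right_carleman_cutoff[OF K0, of "\<tau> n"]
    by (simp add: resolvent_formula_def L_def Kn_def cinner_scaleC_left split_def)
  then show ?thesis
    using equi_C0_add[OF \<open>equi_C0 Kn\<close> equi_C0_cinner[OF right left]] by (simp add: Kn_def[abs_def])
qed

theorem theorem3:
  fixes T_ker :: "real \<times> real \<Rightarrow> complex"
    and T :: "l2 \<Rightarrow>\<^sub>L l2"
    and \<tau> :: "nat \<Rightarrow> real"
    and lam :: "nat \<Rightarrow> complex"
  assumes "K0_kernel T_ker"
    and "induces T_ker T"
    and "\<And>n. \<tau> n > 0"
    and "strict_mono \<tau>"
    and "filterlim \<tau> at_top sequentially"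
    and "\<And>n. K0_kernel (\<lambda>(s, t). cutoff (\<tau> n) s * T_ker (s, t))"
    and "\<And>n. K0_kernel (\<lambda>(s, t). cutoff (\<tau> n) s * T_ker (s, t) * cutoff (\<tau> n) t)"
    and "\<And>n. nuclear (cutoff_op (\<tau> n) o\<^sub>L T)"
    and "\<And>n. nuclear (cutoff_op (\<tau> n) o\<^sub>L T o\<^sub>L cutoff_op (\<tau> n))"
    and "bounded (range lam)"
    and "\<And>n. lam n \<in> regular_values (cutoff_op (\<tau> n) o\<^sub>L T)"
    and "1 \<in> nabla_b (\<lambda>n. scale_op (lam n) (cutoff_op (\<tau> n) o\<^sub>L T))"
  shows "relatively_compact_in C0_space
           (range (\<lambda>n. Bcontfun (resolvent_kernel (cutoff_op (\<tau> n) o\<^sub>L T) (lam n))))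
       \<and> (\<forall>m :: nat \<Rightarrow> nat. \<exists>r L. strict_mono (r :: nat \<Rightarrow> nat) \<and> L \<in> C0_space \<and>
           (\<lambda>k. Bcontfun (resolvent_kernel (cutoff_op (\<tau> (m (r k))) o\<^sub>L T) (lam (m (r k))))) \<longlonglongrightarrow> L)"
proof -
  let ?T = "\<lambda>n. cutoff_op (\<tau> n) o\<^sub>L T"
  let ?K = "\<lambda>n. \<lambda>(s, t). cutoff (\<tau> n) s * T_ker (s, t)"
  obtain B where B: "\<And>n. is_inverse_op (id_blinfun - scale_op (lam n) (?T n)) (B n)"
    using assms(11) unfolding regular_values_def mem_Collect_eq by metis
  obtain C where C: "\<And>n. norm (B n) \<le> C"
    using nabla_b_inverse_bounded[OF assms(12) B] by blast
  obtain D where D: "\<And>n. cmod (lam n) \<le> D"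
    using assms(10) unfolding bounded_iff by blast
  define F where "F n = resolvent_kernel (?T n) (lam n)" for n
  have F: "F n = resolvent_formula (?K n) (B n) (lam n)" for n
    unfolding F_def by (rule resolvent_kernel_eq[OF assms(6) induces_cutoff[OF assms(2)] B])
  have equi: "equi_C0 F"
    using equi_C0_resolvent_formula[OF assms(1,6) D C] by (simp add: F[abs_def])
  have subseq: "\<exists>r L. strict_mono (r :: nat \<Rightarrow> nat) \<and> L \<in> C0_space \<and> (\<lambda>k. Bcontfun (F (m (r k)))) \<longlonglongrightarrow> L"
    for m :: "nat \<Rightarrow> nat"
    using Arzela_Ascoli_C0[OF equi_C0_reindex[OF equi, of m]] by metis
  have "relatively_compact_in C0_space (range (\<lambda>n. Bcontfun (F n)))"
    unfolding relatively_compact_in_def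
  proof (intro conjI allI impI)
    show "range (\<lambda>n. Bcontfun (F n)) \<subseteq> C0_space"
      using Bcontfun_C0(2)[OF equi_C0_imp_C0[OF equi]] by blast
    fix x :: "nat \<Rightarrow> (real \<times> real) \<Rightarrow>\<^sub>C complex"
    assume "range x \<subseteq> range (\<lambda>n. Bcontfun (F n))"
    then have "\<forall>k. \<exists>n. x k = Bcontfun (F n)" by blast
    then obtain m where "\<And>k. x k = Bcontfun (F (m k))" by metis
    then show "\<exists>r l. strict_mono (r :: nat \<Rightarrow> nat) \<and> l \<in> C0_space \<and> (\<lambda>k. x (r k)) \<longlonglongrightarrow> l"
      using subseq[of m] by simp
  qed
  then show ?thesis using subseq unfolding F_def by blast
qed

end
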